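(* Let $p\ge1$, let $\tilde B,\tilde U,\tilde M$ be hermitian positive definite complex $p\times p$ matrices, and let $\alpha,q$ be complex numbers with $\mathrm{Re}(q)>\frac p2$. Then $$\int_{\tilde X>\tilde U}|\det(\tilde X+\tilde B)|^{2\alpha-p}\,|\det(\tilde X-\tilde U)|^{2q-p}\,e^{-\mathrm{tr}(\tilde M\tilde X)}\,d\tilde X$$ $$=\tilde\Gamma_p(2q)\,|\det(\tilde U+\tilde B)|^{\alpha+q-p}\,|\det(\tilde M)|^{-(\alpha+q)}\,e^{\frac12\mathrm{tr}[(\tilde B-\tilde U)\tilde M]}\;\tilde W_{\alpha-q,\,\alpha+q-\frac p2}(\tilde T),$$ where $\tilde T=(\tilde U+\tilde B)^{1/2}\tilde M(\tilde U+\tilde B)^{1/2}$ and the integral is over hermitian $p\times p$ matrices $\tilde X$ with $\tilde X-\tilde U$ positive definite.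
   Context: For hermitian matrices, $\tilde X>\tilde U$ means $\tilde X-\tilde U$ is positive definite; $(\cdot)^*$ is the conjugate transpose; $(\cdot)^{1/2}$ is the hermitian positive definite square root; $|\det(\cdot)|$ is the absolute value of the determinant. Integration over hermitian matrices $\tilde X=X_1+iX_2$ ($X_1$ real symmetric, $X_2$ real skew-symmetric) is with respect to Lebesgue measure $d\tilde X$ in the independent real entries of $X_1$ (those with $i\le j$) and of $X_2$ (those with $i<j$). The complex matrix-variate gamma function is $$\tilde\Gamma_p(\alpha)=\int_{\tilde X=\tilde X^*>0}|\det(\tilde X)|^{\alpha-p}e^{-\mathrm{tr}(\tilde X)}d\tilde X=\pi^{p(p-1)/2}\,\Gamma(\alpha)\Gamma(\alpha-1)\cdots\Gamma(\alpha-p+1),\quad \mathrm{Re}(\alpha)>p-1.$$ The Whittaker function of matrix argument in the complex case, $\tilde W_{\alpha,\beta}(\tilde A)$ for $\tilde A=\tilde A^*>0$ and $\mathrm{Re}(\beta-\alpha)>\frac p2-1$, is defined by $$\int_{\tilde Z=\tilde Z^*>0}|\det(\tilde Z)|^{\beta-\alpha-\frac p2}\,|\det(I+\tilde Z)|^{\beta+\alpha-\frac p2}\,e^{-\mathrm{tr}(\tilde A\tilde Z)}d\tilde Z=|\det(\tilde A)|^{-\beta-\frac p2}\,\tilde\Gamma_p\!\left(\beta-\alpha+\tfrac p2\right)e^{\frac12\mathrm{tr}(\tilde A)}\,\tilde W_{\alpha,\beta}(\tilde A).$$ *)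

theory Defs
  imports "HOL-Analysis.Analysis"
begin

text \<open>
  The matrix order p is \<open>CARD('n)\<close>. The linear order on the index type is needed only to say which
  entries of a hermitian matrix are the independent ones.
\<close>

definition conj_transpose :: "complex^'n^'n \<Rightarrow> complex^'n^'n" where
  "conj_transpose A = (\<chi> i j. cnj (A $ j $ i))"

definition hermitian :: "complex^'n^'n \<Rightarrow> bool" where
  "hermitian A \<longleftrightarrow> conj_transpose A = A"

text \<open>For hermitian \<open>A\<close> the form \<open>v\<^sup>* A v\<close> is real, so taking \<open>Re\<close> loses nothing.\<close>

definition pos_def :: "complex^'n^'n \<Rightarrow> bool" where
  "pos_def A \<longleftrightarrow> hermitian A \<and>
     (\<forall>v. v \<noteq> 0 \<longrightarrow> 0 < Re (\<Sum>i\<in>UNIV. \<Sum>j\<in>UNIV. cnj (v $ i) * A $ i $ j * v $ j))"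

definition pd_sqrt :: "complex^'n^'n \<Rightarrow> complex^'n^'n" where
  "pd_sqrt A = (THE R. pos_def R \<and> R ** R = A)"

definition abs_det :: "complex^'n^'n \<Rightarrow> complex" where
  "abs_det A = of_real (cmod (det A))"

text \<open>
  The \<open>p\<^sup>2\<close> independent real entries of \<open>X = X\<^sub>1 + \<i> X\<^sub>2\<close> are packed into one real matrix \<open>x\<close>:
  for \<open>i \<le> j\<close>, \<open>x $ i $ j\<close> is the entry of the symmetric part \<open>X\<^sub>1\<close>, and
  for \<open>i < j\<close>, \<open>x $ j $ i\<close> is the entry \<open>(i, j)\<close> of the skew-symmetric part \<open>X\<^sub>2\<close>.
\<close>

definition herm_of :: "real^'n::{finite,linorder}^'n::{finite,linorder} \<Rightarrow> complex^'n::{finite,linorder}^'n::{finite,linorder}" where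
  "herm_of x = (\<chi> i j.
     if i < j then Complex (x $ i $ j) (x $ j $ i)
     else if i = j then Complex (x $ i $ i) 0
     else Complex (x $ j $ i) (- (x $ i $ j)))"

text \<open>
  Lebesgue measure on the hermitian matrices, as a Borel measure on all complex matrices that is
  concentrated on the hermitian ones.
\<close>

definition herm_lborel :: "(complex^'n::{finite,linorder}^'n::{finite,linorder}) measure" where
  "herm_lborel = distr lborel borel herm_of"

definition matrix_Gamma :: "'n::{finite,linorder} itself \<Rightarrow> complex \<Rightarrow> complex" where
  "matrix_Gamma _ \<alpha> =
     (LINT X:{X :: complex^'n::{finite,linorder}^'n::{finite,linorder}. pos_def X}|herm_lborel.
        abs_det X powr (\<alpha> - of_nat CARD('n::{finite,linorder})) * exp (- trace X))"

text \<open>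
  The Whittaker function is the solution \<open>w\<close> of its defining equation; the definition is meaningful
  for positive definite \<open>A\<close> and \<open>Re (\<beta> - \<alpha>) > p/2 - 1\<close>.
\<close>

definition matrix_Whittaker ::
    "complex \<Rightarrow> complex \<Rightarrow> complex^'n::{finite,linorder}^'n::{finite,linorder} \<Rightarrow> complex" where
  "matrix_Whittaker \<alpha> \<beta> A =
     (let p = of_nat CARD('n::{finite,linorder}) in
      THE w.
        (LINT Z:{Z :: complex^'n::{finite,linorder}^'n::{finite,linorder}. pos_def Z}|herm_lborel.
           abs_det Z powr (\<beta> - \<alpha> - p / 2) * abs_det (mat 1 + Z) powr (\<beta> + \<alpha> - p / 2)
             * exp (- trace (A ** Z)))
        = abs_det A powr (- \<beta> - p / 2) * matrix_Gamma TYPE('n::{finite,linorder}) (\<beta> - \<alpha> + p / 2)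
            * exp (trace A / 2) * w)"

end

theory Submission
  imports Defs
begin

text \<open>
  Put \<open>D = U + B\<close> and let \<open>C\<close> be its positive definite square root.  Substituting \<open>X = U + C Z C\<close> turns
  \<open>X > U\<close> into \<open>Z > 0\<close>, \<open>det (X - U)\<close> into \<open>det D det Z\<close>, \<open>det (X + B)\<close> into \<open>det D det (I + Z)\<close> and
  \<open>tr (M X)\<close> into \<open>tr (M U) + tr (T Z)\<close> with \<open>T = C M C\<close>, and it has Jacobian \<open>(det C)\<^bsup>2p\<^esup> = (det D)\<^bsup>p\<^esup>\<close>.
  What remains is the integral that defines the Whittaker function at \<open>T\<close>, and
  \<open>det T = det D det M\<close>, \<open>tr T = tr (M D)\<close> collect the factors.  Three facts have to be supplied.

  The square root \<open>C\<close>.  After scaling, \<open>D = I - A\<close> with \<open>A\<close> of norm below 1, and \<open>I - Y\<close> is a square root of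
  \<open>D\<close> exactly if \<open>Y = (A + Y\<^sup>2) / 2\<close>, a contraction (\<open>contraction_square_root\<close>).  Square roots are also used
  to bound entries, determinants and traces on the cone, which gives absolute convergence
  (\<open>pos_def_integrand_bound\<close>, \<open>integrable_pos_def_exp_bound\<close>).

  The Jacobian of \<open>Z \<mapsto> C Z C\<^sup>*\<close>.  It is a positive constant because Lebesgue measure is determined up to a
  factor by translation invariance, hence it is multiplicative in \<open>C\<close>.  A shear is conjugate to its own
  square, so its Jacobian \<open>r\<close> satisfies \<open>r = r\<^sup>2\<close>, that is \<open>r = 1\<close>; for the scaling of one axis the Jacobian can
  be read off; and Schur complements write every positive definite matrix as a product of shears and
  scalings (\<open>congruence_jacobian_pos_def\<close>).

  The Whittaker function is the quotient of its integral by a factor that contains the matrix gamma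
  function, so that factor must not vanish, also for complex arguments.  Eliminating one index by
  a Schur complement splits the gamma integral of order \<open>m + 1\<close> into a Gaussian integral over the \<open>m\<close>
  complex entries of the new column, a scalar gamma integral over its diagonal entry, and the gamma
  integral of order \<open>m\<close> (\<open>block_Gamma_insert\<close>).  This is the product formula for the matrix gamma function, and the
  scalar gamma function has no zeros (\<open>matrix_Gamma_nonzero\<close>).
\<close>

type_synonym 'n cmatrix = "complex^'n^'n"

section \<open>Hermitian forms\<close>

text \<open>
  The real inner product of complex vectors is the real part of the hermitian one, so positive
  definiteness can be handled with the real inner product alone.
\<close>

lemma inner_complex_vec: "(v::complex^'n) \<bullet> w = Re (\<Sum>i\<in>UNIV. cnj (v $ i) * w $ i)"
  by (simp add: inner_vec_def inner_complex_def)

lemma conj_transpose_mult: "conj_transpose (A ** B) = conj_transpose B ** conj_transpose A"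
  by (simp add: conj_transpose_def matrix_matrix_mult_def vec_eq_iff mult.commute)

lemma conj_transpose_involution [simp]: "conj_transpose (conj_transpose A) = A"
  by (simp add: conj_transpose_def vec_eq_iff)

lemma conj_transpose_mat_1 [simp]: "conj_transpose (mat 1) = mat 1"
  by (simp add: conj_transpose_def mat_def vec_eq_iff)

lemma conj_transpose_add: "conj_transpose (A + B) = conj_transpose A + conj_transpose B"
  by (simp add: conj_transpose_def vec_eq_iff)

lemma conj_transpose_diff: "conj_transpose (A - B) = conj_transpose A - conj_transpose B"
  by (simp add: conj_transpose_def vec_eq_iff)

lemma conj_transpose_scaleR: "conj_transpose (c *\<^sub>R A) = c *\<^sub>R conj_transpose A"
  by (simp add: conj_transpose_def vec_eq_iff complex_eq_iff)

lemma det_conj_transpose: "det (conj_transpose A) = cnj (det (A :: complex^'n^'n))"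
proof -
  have "det (conj_transpose A) = det (transpose (\<chi> i j. cnj (A $ i $ j)))"
    by (rule arg_cong[where f = det]) (simp add: conj_transpose_def transpose_def)
  also have "\<dots> = cnj (det A)"
    by (simp add: det_transpose) (simp add: det_def)
  finally show ?thesis .
qed

lemma matrix_mult_add_rdistrib: "(A + B) ** C = A ** C + B ** (C :: 'a::semiring_1^'n^'n)"
  by (simp add: matrix_matrix_mult_def vec_eq_iff distrib_right sum.distrib)

lemma matrix_diff_rdistrib: "(A - B) ** C = A ** C - B ** (C :: 'a::ring_1^'n^'n)"
  by (simp add: matrix_matrix_mult_def vec_eq_iff left_diff_distrib sum_subtractf)

lemma matrix_diff_ldistrib: "C ** (A - B) = C ** A - C ** (B :: 'a::ring_1^'n^'n)"
  by (simp add: matrix_matrix_mult_def vec_eq_iff right_diff_distrib sum_subtractf)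

lemma matrix_mult_scaleR: "(c *\<^sub>R A) ** B = c *\<^sub>R (A ** (B::complex^'n^'n))" "A ** (c *\<^sub>R B) = c *\<^sub>R (A ** B)"
  by (simp_all add: matrix_matrix_mult_def vec_eq_iff scaleR_sum_right)

lemma matrix_vector_scaleR: "(c *\<^sub>R A) *v v = c *\<^sub>R (A *v (v::complex^'n))" "A *v (c *\<^sub>R v) = c *\<^sub>R (A *v v)"
  by (simp_all add: matrix_vector_mult_def vec_eq_iff scaleR_sum_right)

lemma inner_matrix_adjoint: "(A *v v) \<bullet> w = v \<bullet> (conj_transpose A *v (w :: complex^'n))"
proof -
  have "(\<Sum>i\<in>UNIV. cnj (\<Sum>j\<in>UNIV. A $ i $ j * v $ j) * w $ i)
      = (\<Sum>i\<in>UNIV. \<Sum>j\<in>UNIV. cnj (A $ i $ j) * cnj (v $ j) * w $ i)"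
    by (simp add: sum_distrib_right)
  also have "\<dots> = (\<Sum>j\<in>UNIV. \<Sum>i\<in>UNIV. cnj (A $ i $ j) * cnj (v $ j) * w $ i)"
    by (rule sum.swap)
  also have "\<dots> = (\<Sum>j\<in>UNIV. cnj (v $ j) * (\<Sum>i\<in>UNIV. cnj (A $ i $ j) * w $ i))"
    by (simp add: sum_distrib_left algebra_simps)
  finally show ?thesis
    by (simp add: inner_complex_vec matrix_vector_mult_def conj_transpose_def)
qed

lemma pos_def_iff: "pos_def A \<longleftrightarrow> hermitian A \<and> (\<forall>v. v \<noteq> 0 \<longrightarrow> 0 < v \<bullet> (A *v v))"
proof -
  have "(\<Sum>i\<in>UNIV. \<Sum>j\<in>UNIV. cnj (v $ i) * A $ i $ j * v $ j)
     = (\<Sum>i\<in>UNIV. cnj (v $ i) * (A *v v) $ i)" for v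
    by (simp add: matrix_vector_mult_def sum_distrib_left mult.assoc)
  then show ?thesis
    unfolding pos_def_def inner_complex_vec by simp
qed

lemma pos_def_hermitian: "pos_def A \<Longrightarrow> conj_transpose A = A"
  by (simp add: pos_def_def hermitian_def)

lemma pos_def_inner_pos: "pos_def A \<Longrightarrow> v \<noteq> 0 \<Longrightarrow> 0 < v \<bullet> (A *v v)"
  by (simp add: pos_def_iff)

lemma pos_def_inner_nonneg: "pos_def A \<Longrightarrow> 0 \<le> v \<bullet> (A *v v)"
  by (cases "v = 0") (auto simp: pos_def_iff less_imp_le)

lemma pos_def_mat_1: "pos_def (mat 1)"
  by (simp add: pos_def_iff hermitian_def)

lemma pos_def_add: "pos_def A \<Longrightarrow> pos_def B \<Longrightarrow> pos_def (A + B)"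
  by (simp add: pos_def_iff hermitian_def conj_transpose_add matrix_vector_mult_add_rdistrib inner_add_right add_pos_pos)

lemma pos_def_scaleR: "pos_def A \<Longrightarrow> c > 0 \<Longrightarrow> pos_def (c *\<^sub>R A)"
  by (simp add: pos_def_iff hermitian_def conj_transpose_scaleR matrix_vector_scaleR)

lemma pos_def_det_nonzero:
  assumes "pos_def A" shows "det A \<noteq> 0"
proof
  assume "det A = 0"
  then obtain v where "v \<noteq> 0" "A *v v = 0"
    using invertible_det_nz[of A] matrix_left_invertible_ker[of A] invertible_left_inverse[of A] by metis
  with pos_def_inner_pos[OF assms, of v] show False by simp
qed

lemma pos_def_congruence:
  assumes "det C \<noteq> 0"
  shows "pos_def (C ** Z ** conj_transpose C) \<longleftrightarrow> pos_def Z"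
proof -
  have inv: "pos_def (C ** Z ** conj_transpose C)" if Z: "pos_def Z" and C: "det C \<noteq> 0" for C Z :: "complex^'n^'n"
  proof -
    have "conj_transpose (C ** Z ** conj_transpose C) = C ** Z ** conj_transpose C"
      using pos_def_hermitian[OF Z] by (simp add: conj_transpose_mult matrix_mul_assoc)
    moreover have "0 < v \<bullet> ((C ** Z ** conj_transpose C) *v v)" if "v \<noteq> 0" for v
    proof -
      have "det (conj_transpose C) \<noteq> 0" using C by (simp add: det_conj_transpose)
      then have "conj_transpose C *v v \<noteq> 0"
        using that invertible_det_nz[of "conj_transpose C"] matrix_left_invertible_ker[of "conj_transpose C"]
          invertible_left_inverse[of "conj_transpose C"] by metis
      from pos_def_inner_pos[OF Z this] have "0 < (conj_transpose C *v v) \<bullet> (Z *v (conj_transpose C *v v))" .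
      also have "\<dots> = v \<bullet> ((C ** Z ** conj_transpose C) *v v)"
        by (simp add: inner_matrix_adjoint matrix_vector_mul_assoc matrix_mul_assoc)
      finally show ?thesis .
    qed
    ultimately show ?thesis by (simp add: pos_def_iff hermitian_def)
  qed
  from assms obtain D where D: "D ** C = mat 1" "C ** D = mat 1"
    by (metis invertible_det_nz invertible_def)
  then have "det D * det C = 1" by (metis det_I det_mul)
  then have "det D \<noteq> 0" by auto
  have D': "conj_transpose C ** conj_transpose D = mat 1"
    using D by (metis conj_transpose_mult conj_transpose_mat_1)
  have "D ** (C ** Z ** conj_transpose C) ** conj_transpose D
     = (D ** C) ** Z ** (conj_transpose C ** conj_transpose D)"
    by (simp only: matrix_mul_assoc)
  then have "D ** (C ** Z ** conj_transpose C) ** conj_transpose D = Z"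
    by (simp add: D D')
  with inv[OF _ assms, of Z] inv[OF _ \<open>det D \<noteq> 0\<close>, of "C ** Z ** conj_transpose C"] show ?thesis
    by auto
qed

lemma pos_def_coercive:
  assumes "pos_def (A :: complex^'n^'n)"
  obtains e where "e > 0" "\<And>v. e * (norm v)\<^sup>2 \<le> v \<bullet> (A *v v)"
proof -
  have "compact (sphere (0::complex^'n) 1)" by simp
  moreover have "sphere (0::complex^'n) 1 \<noteq> {}" by simp
  moreover have "continuous_on (sphere (0::complex^'n) 1) (\<lambda>v. v \<bullet> (A *v v))"
    by (intro continuous_intros linear_continuous_on matrix_vector_mul_bounded_linear)
  ultimately obtain u where u: "u \<in> sphere 0 1" and min: "\<And>v. v \<in> sphere 0 1 \<Longrightarrow> u \<bullet> (A *v u) \<le> v \<bullet> (A *v v)"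
    using continuous_attains_inf[of "sphere (0::complex^'n) 1" "\<lambda>v. v \<bullet> (A *v v)"] by blast
  have "u \<bullet> (A *v u) * (norm v)\<^sup>2 \<le> v \<bullet> (A *v v)" for v
  proof (cases "v = 0")
    case False
    have "(v /\<^sub>R norm v) \<bullet> (A *v (v /\<^sub>R norm v)) = (v \<bullet> (A *v v)) / (norm v)\<^sup>2"
      by (simp add: matrix_vector_scaleR power2_eq_square divide_inverse)
    moreover have "v /\<^sub>R norm v \<in> sphere 0 1" using False by simp
    ultimately have "u \<bullet> (A *v u) \<le> (v \<bullet> (A *v v)) / (norm v)\<^sup>2" using min by metis
    then show ?thesis using False by (simp add: pos_le_divide_eq)
  qed simp
  moreover have "u \<noteq> 0" using u by auto
  ultimately show ?thesis using that pos_def_inner_pos[OF assms, of u] by blast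
qed

lemma inner_lower_bound_pos_def:
  assumes "hermitian A" "e > 0" "\<And>v. e * (norm v)\<^sup>2 \<le> v \<bullet> (A *v v)"
  shows "pos_def A"
  unfolding pos_def_iff
proof (intro conjI allI impI assms(1))
  fix v :: "complex^'a" assume "v \<noteq> 0"
  then have "0 < e * (norm v)\<^sup>2" using \<open>e > 0\<close> by simp
  with assms(3)[of v] show "0 < v \<bullet> (A *v v)" by linarith
qed

section \<open>The positive definite square root\<close>

lemma norm_matrix_columns: "(norm (A :: complex^'n^'m))\<^sup>2 = (\<Sum>j\<in>UNIV. (norm (column j A))\<^sup>2)"
  by (simp add: norm_vec_def L2_set_def sum_nonneg column_def) (rule sum.swap)

lemma column_matrix_mult: "column j (A ** B) = A *v column j B"
  by (simp add: column_def matrix_matrix_mult_def matrix_vector_mult_def)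

lemma norm_conj_transpose: "norm (conj_transpose A) = norm (A :: complex^'n^'n)"
proof -
  have "(norm (conj_transpose A))\<^sup>2 = (norm A)\<^sup>2"
    unfolding norm_matrix_columns[of "conj_transpose A"]
    by (simp add: norm_vec_def L2_set_def sum_nonneg column_def conj_transpose_def)
  then show ?thesis by (metis norm_ge_zero power2_eq_iff_nonneg)
qed

lemma norm_matrix_mult_le:
  fixes A B :: "complex^'n^'n"
  assumes "\<And>v. norm (A *v v) \<le> r * norm v"
  shows "norm (A ** B) \<le> r * norm B"
proof -
  have r: "0 \<le> r" using order_trans[OF norm_ge_zero assms[of "axis undefined 1"]]
    by simp
  have "(norm (A ** B))\<^sup>2 = (\<Sum>j\<in>UNIV. (norm (A *v column j B))\<^sup>2)"
    by (simp add: norm_matrix_columns column_matrix_mult)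
  also have "\<dots> \<le> (\<Sum>j\<in>UNIV. (r * norm (column j B))\<^sup>2)"
    by (intro sum_mono power_mono assms) simp
  also have "\<dots> = (r * norm B)\<^sup>2"
    by (simp add: norm_matrix_columns power_mult_distrib sum_distrib_left)
  finally show ?thesis using r by (simp add: power2_le_iff_abs_le)
qed

lemma continuous_on_matrix_mult_vec: "continuous_on S (\<lambda>A. (A :: complex^'n^'n) *v v)"
  unfolding matrix_vector_mult_def by (intro continuous_intros)

lemma closed_hermitian: "closed {A. hermitian (A :: complex^'n^'n)}"
  unfolding hermitian_def conj_transpose_def vec_eq_iff
  by (simp, intro closed_Collect_all closed_Collect_eq continuous_intros)

text \<open>
  The equation \<open>(I - Y)\<^sup>2 = I - A\<close> reads \<open>Y = (A + Y\<^sup>2) / 2\<close>.  On hermitian matrices of operator norm at most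
  \<open>r\<close> the right-hand side is an \<open>r\<close>-contraction for the Frobenius norm, because
  \<open>Y\<^sup>2 - Z\<^sup>2 = Y (Y - Z) + (Y - Z) Z\<close>.
\<close>

lemma contraction_square_root:
  fixes A :: "complex^'n^'n"
  assumes "hermitian A" and a: "0 \<le> a" "a < 1" and A: "\<And>v. norm (A *v v) \<le> a * norm v"
  obtains R where "pos_def R" "R ** R = mat 1 - A"
proof -
  \<comment> \<open>The scalar solution of \<open>r = (a + r\<^sup>2) / 2\<close>, so that the ball of radius \<open>r\<close> is mapped to itself.\<close>
  define r where "r = 1 - sqrt (1 - a)"
  have r: "0 \<le> r" "r < 1" and rr: "(a + r\<^sup>2) / 2 = r"
    using a by (auto simp: r_def power2_eq_square algebra_simps field_simps)
  define S where "S = {Y :: complex^'n^'n. hermitian Y \<and> (\<forall>v. norm (Y *v v) \<le> r * norm v)}"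
  define f where "f Y = (1/2) *\<^sub>R (A + Y ** Y)" for Y
  have "closed S"
    unfolding S_def
    by (intro closed_Collect_conj closed_hermitian closed_Collect_all closed_Collect_le
        continuous_intros continuous_on_matrix_mult_vec)
  then have "complete S" by (simp add: complete_eq_closed)
  moreover have "0 \<in> S" using r by (simp add: S_def hermitian_def conj_transpose_def vec_eq_iff)
  then have "S \<noteq> {}" by auto
  moreover have "f ` S \<subseteq> S"
  proof safe
    fix Y assume Y: "Y \<in> S"
    have "hermitian (f Y)" using Y assms(1)
      by (simp add: S_def hermitian_def f_def conj_transpose_scaleR conj_transpose_add conj_transpose_mult)
    moreover have "norm (f Y *v v) \<le> r * norm v" for v
    proof -
      have "norm (Y *v (Y *v v)) \<le> r * norm (Y *v v)" using Y by (simp add: S_def)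
      also have "\<dots> \<le> r * (r * norm v)" using Y r by (intro mult_left_mono) (auto simp: S_def)
      finally have "norm (A *v v + Y *v (Y *v v)) \<le> a * norm v + r * (r * norm v)"
        using A[of v] norm_triangle_ineq[of "A *v v" "Y *v (Y *v v)"] by linarith
      then have "norm (f Y *v v) \<le> (a * norm v + r * (r * norm v)) / 2"
        by (simp add: f_def matrix_vector_scaleR matrix_vector_mult_add_rdistrib matrix_vector_mul_assoc)
      also have "\<dots> = (a + r\<^sup>2) / 2 * norm v" by (simp add: power2_eq_square algebra_simps)
      finally show ?thesis by (simp add: rr)
    qed
    ultimately show "f Y \<in> S" by (simp add: S_def)
  qed
  moreover have "dist (f Y) (f Z) \<le> r * dist Y Z" if "Y \<in> S \<and> Z \<in> S" for Y Z
  proof -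
    have Y: "conj_transpose Y = Y" "\<And>v. norm (Y *v v) \<le> r * norm v"
      and Z: "conj_transpose Z = Z" "\<And>v. norm (Z *v v) \<le> r * norm v"
      using that by (auto simp: S_def hermitian_def)
    have "norm ((Y - Z) ** Z) = norm (conj_transpose ((Y - Z) ** Z))"
      by (simp only: norm_conj_transpose)
    also have "\<dots> = norm (Z ** (Y - Z))"
      by (simp add: conj_transpose_mult conj_transpose_diff Y Z)
    also have "\<dots> \<le> r * norm (Y - Z)" by (rule norm_matrix_mult_le) (rule Z)
    finally have "norm (Y ** (Y - Z) + (Y - Z) ** Z) \<le> r * norm (Y - Z) + r * norm (Y - Z)"
      using norm_matrix_mult_le[OF Y(2), of "Y - Z"] norm_triangle_ineq by (smt (verit))
    moreover have "f Y - f Z = (1/2) *\<^sub>R (Y ** (Y - Z) + (Y - Z) ** Z)"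
      by (simp add: f_def matrix_diff_ldistrib matrix_diff_rdistrib algebra_simps)
    ultimately show ?thesis by (simp add: dist_norm)
  qed
  ultimately obtain Y where Y: "Y \<in> S" "f Y = Y"
    using Banach_fix[of S r f] r by auto
  have "Y + Y = A + Y ** Y"
    using arg_cong[OF Y(2), of "\<lambda>Z. 2 *\<^sub>R Z"] by (simp add: f_def scaleR_2)
  then have "(mat 1 - Y) ** (mat 1 - Y) = mat 1 - A"
    by (simp add: matrix_diff_ldistrib matrix_diff_rdistrib algebra_simps)
  moreover have "pos_def (mat 1 - Y)"
  proof (rule inner_lower_bound_pos_def[where e = "1 - r"])
    show "hermitian (mat 1 - Y)" using Y by (simp add: S_def hermitian_def conj_transpose_diff)
    fix v :: "complex^'n"
    have "v \<bullet> (Y *v v) \<le> norm v * norm (Y *v v)" by (rule norm_cauchy_schwarz)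
    also have "\<dots> \<le> norm v * (r * norm v)" using Y by (intro mult_left_mono) (auto simp: S_def)
    finally show "(1 - r) * (norm v)\<^sup>2 \<le> v \<bullet> ((mat 1 - Y) *v v)"
      by (simp add: matrix_vector_mult_diff_rdistrib inner_diff_right power2_norm_eq_inner algebra_simps)
        (simp add: power2_norm_eq_inner[symmetric] power2_eq_square)
  qed (use r in simp)
  ultimately show ?thesis using that by blast
qed

text \<open>
  A small multiple \<open>t P\<close> differs from the identity by a contraction:
  \<open>\<parallel>v - t P v\<parallel>\<^sup>2 \<le> (1 - 2 t m + t\<^sup>2 K\<^sup>2) \<parallel>v\<parallel>\<^sup>2\<close> if \<open>m\<close> bounds the form of \<open>P\<close> from below and \<open>K\<close> its norm from above,
  and \<open>t = m / K\<^sup>2\<close> minimizes the factor.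
\<close>

lemma pos_def_square_root_exists:
  assumes P: "pos_def (P :: complex^'n^'n)"
  obtains R where "pos_def R" "R ** R = P"
proof -
  obtain m where m: "m > 0" "\<And>v. m * (norm v)\<^sup>2 \<le> v \<bullet> (P *v v)"
    using pos_def_coercive[OF P] by blast
  obtain K where K: "K > 0" "\<And>v. norm (P *v v) \<le> norm v * K"
    using bounded_linear.pos_bounded[OF matrix_vector_mul_bounded_linear[of P]] by blast
  define t where "t = m / K\<^sup>2"
  have t: "t > 0" using m K by (simp add: t_def)
  define b where "b = 1 - m\<^sup>2 / K\<^sup>2"
  have sq: "(norm ((mat 1 - t *\<^sub>R P) *v v))\<^sup>2 \<le> b * (norm v)\<^sup>2" for v
  proof -
    have "(norm ((mat 1 - t *\<^sub>R P) *v v))\<^sup>2 = (norm v)\<^sup>2 - 2 * t * (v \<bullet> (P *v v)) + t\<^sup>2 * (norm (P *v v))\<^sup>2"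
      by (simp add: matrix_vector_mult_diff_rdistrib matrix_vector_scaleR power2_norm_eq_inner
          inner_diff_left inner_diff_right inner_commute[of "P *v v" v])
        (simp add: power2_eq_square algebra_simps)
    also have "\<dots> \<le> (norm v)\<^sup>2 - 2 * t * (m * (norm v)\<^sup>2) + t\<^sup>2 * (norm v * K)\<^sup>2"
      using m t K by (intro add_mono diff_mono mult_left_mono power_mono) auto
    also have "\<dots> = b * (norm v)\<^sup>2"
      using K(1) by (simp add: b_def t_def field_simps power2_eq_square)
    finally show ?thesis .
  qed
  have b0: "0 \<le> b"
  proof -
    have "0 \<le> b * (norm (axis undefined 1 :: complex^'n))\<^sup>2" using sq[of "axis undefined 1"]
      by (meson order_trans zero_le_power2)
    then show ?thesis by simp
  qed
  have "norm ((mat 1 - t *\<^sub>R P) *v v) \<le> sqrt b * norm v" for v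
    using real_sqrt_le_mono[OF sq[of v]] by (simp add: real_sqrt_mult)
  moreover have "sqrt b < 1" using m K by (simp add: b_def)
  moreover have "hermitian (mat 1 - t *\<^sub>R P)"
    using P by (simp add: pos_def_iff hermitian_def conj_transpose_diff conj_transpose_scaleR)
  ultimately obtain R where R: "pos_def R" "R ** R = mat 1 - (mat 1 - t *\<^sub>R P)"
    using contraction_square_root[of "mat 1 - t *\<^sub>R P" "sqrt b"] b0 by auto
  have "((1 / sqrt t) *\<^sub>R R) ** ((1 / sqrt t) *\<^sub>R R) = P"
    using R(2) t by (simp add: matrix_mult_scaleR)
  moreover have "pos_def ((1 / sqrt t) *\<^sub>R R)" using R(1) t by (simp add: pos_def_scaleR)
  ultimately show ?thesis using that by blast
qed

lemma trace_hermitian_congruence: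
  assumes "conj_transpose S = S"
  shows "Re (trace (S ** T ** S)) = (\<Sum>j\<in>UNIV. column j S \<bullet> (T *v column j S))"
proof -
  have "(S ** T ** S) $ j $ j = (\<Sum>i\<in>UNIV. cnj (column j S $ i) * (T *v column j S) $ i)" for j
  proof -
    have "S $ j $ i = cnj (S $ i $ j)" for i
      using arg_cong[OF assms, of "\<lambda>A. A $ j $ i"] by (simp add: conj_transpose_def)
    then have "(S ** (T ** S)) $ j $ j = (\<Sum>i\<in>UNIV. cnj (S $ i $ j) * (T ** S) $ i $ j)"
      by (simp add: matrix_matrix_mult_def)
    also have "\<dots> = (\<Sum>i\<in>UNIV. cnj (column j S $ i) * (T *v column j S) $ i)"
      by (simp add: column_def matrix_matrix_mult_def matrix_vector_mult_def)
    finally show ?thesis by (simp add: matrix_mul_assoc)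
  qed
  then show ?thesis by (simp add: trace_def inner_complex_vec)
qed

text \<open>
  For \<open>D = R - S\<close> the equation \<open>R\<^sup>2 = S\<^sup>2\<close> says \<open>R D + D S = 0\<close>.  Multiplying by \<open>D\<close> and taking traces gives
  \<open>tr (D R D) + tr (D S D) = 0\<close>, a sum of values of positive definite forms at the columns of \<open>D\<close>.
\<close>

lemma pos_def_square_root_unique:
  assumes R: "pos_def R" and S: "pos_def S" and eq: "R ** R = S ** S"
  shows "R = (S :: complex^'n^'n)"
proof -
  define D where "D = R - S"
  have D: "conj_transpose D = D"
    using R S by (simp add: D_def conj_transpose_diff pos_def_hermitian)
  have "R ** D + D ** S = 0"
    by (simp add: D_def matrix_diff_ldistrib matrix_diff_rdistrib eq)
  then have "trace (D ** (R ** D + D ** S)) = 0" by (simp add: trace_def)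
  then have "trace (D ** R ** D) + trace (D ** D ** S) = 0"
    by (simp add: matrix_add_ldistrib matrix_mul_assoc trace_add)
  moreover have "trace (D ** D ** S) = trace (D ** S ** D)"
    by (metis matrix_mul_assoc trace_mul_sym)
  ultimately have "Re (trace (D ** R ** D)) + Re (trace (D ** S ** D)) = 0"
    by (metis plus_complex.sel(1) zero_complex.sel(1))
  then have "(\<Sum>j\<in>UNIV. column j D \<bullet> (R *v column j D)) + (\<Sum>j\<in>UNIV. column j D \<bullet> (S *v column j D)) = 0"
    by (simp add: trace_hermitian_congruence[OF D])
  moreover have "0 \<le> (\<Sum>j\<in>UNIV. column j D \<bullet> (R *v column j D))"
    "0 \<le> (\<Sum>j\<in>UNIV. column j D \<bullet> (S *v column j D))"
    using R S by (auto intro!: sum_nonneg pos_def_inner_nonneg)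
  ultimately have "(\<Sum>j\<in>UNIV. column j D \<bullet> (R *v column j D)) = 0" by linarith
  then have "column j D \<bullet> (R *v column j D) = 0" for j
    using R by (subst (asm) sum_nonneg_eq_0_iff) (auto intro: pos_def_inner_nonneg)
  then have "column j D = 0" for j
    using pos_def_inner_pos[OF R, of "column j D"] by force
  then have "D = 0" by (simp add: vec_eq_iff column_def)
  then show ?thesis by (simp add: D_def)
qed

lemma pd_sqrt:
  assumes "pos_def P" shows "pos_def (pd_sqrt P)" "pd_sqrt P ** pd_sqrt P = P"
proof -
  have "\<exists>!R. pos_def R \<and> R ** R = P"
    using pos_def_square_root_exists[OF assms] pos_def_square_root_unique by metis
  from theI'[OF this] show "pos_def (pd_sqrt P)" "pd_sqrt P ** pd_sqrt P = P"
    unfolding pd_sqrt_def by auto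
qed

section \<open>Bounds on the cone of positive definite matrices\<close>

lemma trace_pos_def_eq_norm:
  assumes S: "conj_transpose S = (S :: complex^'n^'n)"
  shows "Re (trace (S ** S)) = (norm S)\<^sup>2"
  using trace_hermitian_congruence[OF S, of "mat 1"]
  by (simp add: norm_matrix_columns power2_norm_eq_inner)

lemma pos_def_trace_nonneg: "pos_def Z \<Longrightarrow> 0 \<le> Re (trace Z)"
  using pd_sqrt[of Z] trace_pos_def_eq_norm[of "pd_sqrt Z"] by (simp add: pos_def_hermitian)

text \<open>
  For a hermitian \<open>S\<close>, entries of \<open>S\<^sup>2\<close> are inner products of columns of \<open>S\<close>, and the trace of \<open>S\<^sup>2\<close> is the
  sum of the squared lengths of the columns.
\<close>

lemma pos_def_entry_le_trace:
  assumes "pos_def (Z :: complex^'n^'n)"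
  shows "cmod (Z $ i $ j) \<le> Re (trace Z)"
proof -
  define S where "S = pd_sqrt Z"
  have S: "conj_transpose S = S" "S ** S = Z"
    using pd_sqrt[OF assms] by (simp_all add: S_def pos_def_hermitian)
  have sym: "cmod (S $ i $ k) = cmod (S $ k $ i)" for k
    using arg_cong[OF S(1), of "\<lambda>A. A $ i $ k"] by (metis (no_types) S(1) complex_mod_cnj conj_transpose_def vec_lambda_beta)
  have col: "(\<Sum>k\<in>UNIV. (cmod (S $ k $ l))\<^sup>2) \<le> (norm S)\<^sup>2" for l
  proof -
    have "(\<Sum>k\<in>UNIV. (cmod (S $ k $ l))\<^sup>2) = (norm (column l S))\<^sup>2"
      by (simp add: norm_vec_def L2_set_def column_def sum_nonneg)
    also have "\<dots> \<le> (norm S)\<^sup>2" unfolding norm_matrix_columns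
      by (rule member_le_sum) auto
    finally show ?thesis .
  qed
  have "cmod (Z $ i $ j) \<le> (\<Sum>k\<in>UNIV. cmod (S $ i $ k * S $ k $ j))"
    unfolding S(2)[symmetric] matrix_matrix_mult_def by (simp add: sum_norm_le)
  also have "\<dots> \<le> (\<Sum>k\<in>UNIV. ((cmod (S $ k $ i))\<^sup>2 + (cmod (S $ k $ j))\<^sup>2) / 2)"
  proof (rule sum_mono)
    fix k
    have "2 * (cmod (S $ k $ i) * cmod (S $ k $ j)) \<le> (cmod (S $ k $ i))\<^sup>2 + (cmod (S $ k $ j))\<^sup>2"
      using sum_squares_bound[of "cmod (S $ k $ i)" "cmod (S $ k $ j)"] by (simp add: mult.assoc)
    then show "cmod (S $ i $ k * S $ k $ j) \<le> ((cmod (S $ k $ i))\<^sup>2 + (cmod (S $ k $ j))\<^sup>2) / 2"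
      by (simp add: norm_mult sym)
  qed
  also have "\<dots> \<le> (norm S)\<^sup>2"
    using col[of i] col[of j] by (simp add: sum_divide_distrib[symmetric] sum.distrib)
  also have "\<dots> = Re (trace Z)" using trace_pos_def_eq_norm[OF S(1)] S(2) by simp
  finally show ?thesis .
qed

text \<open>
  With \<open>S\<^sup>2 = Z\<close>, \<open>tr (T Z) = tr (S T S)\<close> is the sum of the form of \<open>T\<close> over the columns of \<open>S\<close>.
\<close>

lemma trace_mult_coercive:
  assumes Z: "pos_def (Z :: complex^'n^'n)" and e: "\<And>v. e * (norm v)\<^sup>2 \<le> v \<bullet> (T *v v)"
  shows "e * Re (trace Z) \<le> Re (trace (T ** Z))"
proof -
  define S where "S = pd_sqrt Z"
  have S: "conj_transpose S = S" "S ** S = Z"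
    using pd_sqrt[OF Z] by (simp_all add: S_def pos_def_hermitian)
  have "e * Re (trace Z) = e * (\<Sum>j\<in>UNIV. (norm (column j S))\<^sup>2)"
    by (simp add: S(2)[symmetric] trace_pos_def_eq_norm[OF S(1)] norm_matrix_columns)
  also have "\<dots> \<le> (\<Sum>j\<in>UNIV. column j S \<bullet> (T *v column j S))"
    unfolding sum_distrib_left by (intro sum_mono e)
  also have "\<dots> = Re (trace (S ** (T ** S)))"
    by (simp add: trace_hermitian_congruence[OF S(1)] matrix_mul_assoc)
  also have "trace (S ** (T ** S)) = trace (T ** Z)"
    by (metis S(2) matrix_mul_assoc trace_mul_sym)
  finally show ?thesis .
qed

lemma cmod_det_le:
  fixes A :: "complex^'n^'n"
  assumes "\<And>i j. cmod (A $ i $ j) \<le> b"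
  shows "cmod (det A) \<le> fact CARD('n) * b ^ CARD('n)"
proof -
  have "cmod (det A) \<le> (\<Sum>p | p permutes (UNIV :: 'n set). cmod (of_int (sign p) * (\<Prod>i\<in>UNIV. A $ i $ p i)))"
    unfolding det_def by (rule norm_sum)
  also have "\<dots> \<le> (\<Sum>p | p permutes (UNIV :: 'n set). b ^ CARD('n))"
  proof (rule sum_mono)
    fix p assume "p \<in> {p. p permutes (UNIV :: 'n set)}"
    have "cmod (of_int (sign p) * (\<Prod>i\<in>UNIV. A $ i $ p i)) = (\<Prod>i\<in>UNIV. cmod (A $ i $ p i))"
      by (simp add: norm_mult prod_norm sign_def)
    also have "\<dots> \<le> (\<Prod>i\<in>(UNIV :: 'n set). b)" by (intro prod_mono) (simp add: assms)
    finally show "cmod (of_int (sign p) * (\<Prod>i\<in>UNIV. A $ i $ p i)) \<le> b ^ CARD('n)" by simp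
  qed
  also have "\<dots> = fact CARD('n) * b ^ CARD('n)"
    by (simp add: card_permutations[OF refl])
  finally show ?thesis .
qed

text \<open>
  The inverse of \<open>I + Z\<close> is a contraction, so its entries are at most 1 and its determinant is at most
  the number of permutations.  A lower bound is what negative powers of \<open>det (I + Z)\<close> require.
\<close>

lemma cmod_det_id_plus_pos_def_ge:
  assumes Z: "pos_def (Z :: complex^'n^'n)"
  shows "1 / fact CARD('n) \<le> cmod (det (mat 1 + Z))"
proof -
  have "det (mat 1 + Z) \<noteq> 0" by (intro pos_def_det_nonzero pos_def_add pos_def_mat_1 Z)
  then obtain D where D: "(mat 1 + Z) ** D = mat 1"
    by (metis invertible_det_nz invertible_def)
  have contr: "norm (D *v v) \<le> norm v" for v
  proof -
    define u where "u = D *v v"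
    have "(mat 1 + Z) *v u = v" by (simp add: u_def D matrix_vector_mul_assoc)
    then have "v = u + Z *v u" by (simp add: matrix_vector_mult_add_rdistrib)
    then have "(norm u)\<^sup>2 \<le> u \<bullet> v"
      using pos_def_inner_nonneg[OF Z, of u] by (simp add: inner_add_right power2_norm_eq_inner)
    also have "\<dots> \<le> norm u * norm v" by (rule norm_cauchy_schwarz)
    finally have "norm u * norm u \<le> norm u * norm v" by (simp add: power2_eq_square)
    then show ?thesis by (cases "u = 0") (auto simp: u_def)
  qed
  have "cmod (D $ i $ j) \<le> 1" for i j
  proof -
    have "D $ i $ j = (D *v axis j 1) $ i" 
      by (simp add: matrix_vector_mult_def axis_def if_distrib[of "\<lambda>x. _ * x"] cong: if_cong)
    then show ?thesis using Finite_Cartesian_Product.norm_nth_le[of "D *v axis j 1" i] contr[of "axis j 1"] by simp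
  qed
  then have "cmod (det D) \<le> fact CARD('n)" using cmod_det_le[of D 1] by simp
  moreover have "cmod (det (mat 1 + Z)) * cmod (det D) = 1"
    by (metis D det_I det_mul norm_mult norm_one)
  ultimately have "1 \<le> cmod (det (mat 1 + Z)) * fact CARD('n)"
    by (metis mult_left_mono norm_ge_zero)
  then show ?thesis by (simp add: divide_le_eq)
qed

lemma powr_le_exp:
  assumes "N \<ge> 0" "e > (0::real)"
  obtains C where "C \<ge> 0" "\<And>t. t \<ge> 0 \<Longrightarrow> (1 + t) powr N \<le> C * exp (e * t)"
proof -
  define d where "d = e / (N + 1)"
  have d: "d > 0" and Nd: "N * d \<le> e" using assms by (auto simp: d_def field_simps)
  define K where "K = 1 + 1 / d"
  have K: "K > 0" using d by (simp add: K_def add_pos_pos)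
  have "(1 + t) powr N \<le> K powr N * exp (e * t)" if t: "t \<ge> 0" for t
  proof -
    have "1 + t \<le> K * (1 + d * t)"
      using d t by (simp add: K_def algebra_simps)
    also have "\<dots> \<le> K * exp (d * t)" using K by (intro mult_left_mono) (auto simp: exp_ge_add_one_self)
    finally have "(1 + t) powr N \<le> (K * exp (d * t)) powr N"
      using assms t by (intro powr_mono2) auto
    also have "\<dots> = K powr N * exp (N * d * t)"
      using K by (simp add: powr_mult exp_powr_real mult_ac)
    also have "\<dots> \<le> K powr N * exp (e * t)"
      using t Nd by (intro mult_left_mono) (auto intro: mult_right_mono)
    finally show ?thesis .
  qed
  then show ?thesis using that[of "K powr N"] by simp
qed

lemma cmod_abs_det_powr: "cmod (abs_det X powr s) = cmod (det X) powr Re s"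
  unfolding abs_det_def by (subst norm_powr_real_powr) auto

text \<open>
  The determinants are bounded by powers of \<open>1 + tr Z\<close>, and half of the exponential decay absorbs these.
\<close>

lemma pos_def_integrand_bound:
  fixes T :: "complex^'n^'n"
  assumes T: "pos_def T" and s: "0 \<le> Re s"
  obtains C e where "C \<ge> 0" "e > 0"
    "\<And>Z :: complex^'n^'n. pos_def Z \<Longrightarrow>
       cmod (abs_det Z powr s * abs_det (mat 1 + Z) powr t * exp (- trace (T ** Z)))
         \<le> C * exp (- e * Re (trace Z))"
proof -
  obtain d where d: "d > 0" "\<And>v. d * (norm v)\<^sup>2 \<le> v \<bullet> (T *v v)"
    using pos_def_coercive[OF T] by blast
  define p where "p = CARD('n)"
  define F :: real where "F = fact p"
  have F: "F \<ge> 1" by (simp add: F_def)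
  define m where "m = max (Re t) 0"
  define N where "N = real p * (Re s + m)"
  have N: "N \<ge> 0" using s by (simp add: N_def m_def)
  obtain C where C: "C \<ge> 0" "\<And>x. x \<ge> 0 \<Longrightarrow> (1 + x) powr N \<le> C * exp (d / 2 * x)"
    using powr_le_exp[OF N, of "d / 2"] d by auto
  define C' where "C' = F powr (Re s + \<bar>Re t\<bar>) * C"
  have "cmod (abs_det Z powr s * abs_det (mat 1 + Z) powr t * exp (- trace (T ** Z)))
         \<le> C' * exp (- (d / 2) * Re (trace Z))" if Z: "pos_def Z" for Z :: "complex^'n^'n"
  proof -
    define x where "x = Re (trace Z)"
    have x: "x \<ge> 0" using pos_def_trace_nonneg[OF Z] by (simp add: x_def)
    define b where "b = (1 + x) powr real p"
    have b: "b \<ge> 1" using x by (auto simp: b_def intro: ge_one_powr_ge_zero)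
    have bp: "b = (1 + x) ^ p" using x by (simp add: b_def powr_realpow)
    have entry: "cmod (Z $ i $ j) \<le> x" for i j
      using pos_def_entry_le_trace[OF Z, of i j] by (simp add: x_def)
    have "cmod (det Z) \<le> F * x ^ p"
      using cmod_det_le[of Z x, OF entry] by (simp add: F_def p_def)
    also have "\<dots> \<le> F * b" unfolding bp using F x by (intro mult_left_mono power_mono) auto
    finally have detZ: "cmod (det Z) \<le> F * b" .
    have "cmod ((mat 1 + Z) $ i $ j) \<le> 1 + x" for i j
      using norm_triangle_ineq[of "mat 1 $ i $ j" "Z $ i $ j"] entry[of i j]
      by (auto simp: mat_def split: if_splits intro: order_trans)
    then have det1Z: "cmod (det (mat 1 + Z)) \<le> F * b"
      using cmod_det_le[of "mat 1 + Z" "1 + x"] by (simp add: F_def p_def bp)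
    have low: "1 / F \<le> cmod (det (mat 1 + Z))"
      using cmod_det_id_plus_pos_def_ge[OF Z] by (simp add: F_def p_def)
    have 1: "cmod (det Z) powr Re s \<le> (F * b) powr Re s"
      using s detZ by (intro powr_mono2) auto
    have 2: "cmod (det (mat 1 + Z)) powr Re t \<le> F powr \<bar>Re t\<bar> * b powr m"
    proof (cases "Re t \<ge> 0")
      case True
      then show ?thesis
        using powr_mono2[OF True _ det1Z] F b by (simp add: m_def powr_mult)
    next
      case False
      then have "cmod (det (mat 1 + Z)) powr Re t \<le> (1 / F) powr Re t"
        using low F by (intro powr_mono2') auto
      also have "\<dots> = F powr \<bar>Re t\<bar>" using False F by (simp add: powr_divide powr_minus_divide)
      finally show ?thesis using False b by (simp add: m_def)
    qed
    have 3: "exp (- Re (trace (T ** Z))) \<le> exp (- d * x)"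
      using trace_mult_coercive[OF Z d(2)] by (simp add: x_def)
    have "cmod (abs_det Z powr s * abs_det (mat 1 + Z) powr t * exp (- trace (T ** Z)))
       = cmod (det Z) powr Re s * cmod (det (mat 1 + Z)) powr Re t * exp (- Re (trace (T ** Z)))"
      by (simp add: norm_mult cmod_abs_det_powr)
    also have "\<dots> \<le> ((F * b) powr Re s * (F powr \<bar>Re t\<bar> * b powr m)) * exp (- d * x)"
      by (intro mult_mono 1 2 3) auto
    also have "(F * b) powr Re s * (F powr \<bar>Re t\<bar> * b powr m) = F powr (Re s + \<bar>Re t\<bar>) * b powr (Re s + m)"
      using F b by (simp add: powr_mult powr_add)
    also have "b powr (Re s + m) = (1 + x) powr N"
      by (simp add: b_def powr_powr N_def)
    also have "F powr (Re s + \<bar>Re t\<bar>) * (1 + x) powr N * exp (- d * x)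
       \<le> F powr (Re s + \<bar>Re t\<bar>) * (C * exp (d / 2 * x)) * exp (- d * x)"
      using C(2)[OF x] by (intro mult_left_mono mult_right_mono) auto
    also have "\<dots> = C' * exp (- (d / 2) * x)"
      by (simp add: C'_def mult_exp_exp)
    finally show ?thesis by (simp add: x_def)
  qed
  moreover have "C' \<ge> 0" using C by (simp add: C'_def)
  ultimately show ?thesis using that[of C' "d / 2"] d by auto
qed

section \<open>Measurability\<close>

text \<open>
  This writes the cone as a countable union of closed sets, from which measurability is immediate.
\<close>

lemma pos_def_iff_coercive:
  "pos_def A \<longleftrightarrow> hermitian A \<and> (\<exists>n. \<forall>v. (norm v)\<^sup>2 / real (Suc n) \<le> v \<bullet> (A *v v))" (is "?l \<longleftrightarrow> ?r")
proof
  assume A: ?l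
  then obtain e where e: "e > 0" "\<And>v. e * (norm v)\<^sup>2 \<le> v \<bullet> (A *v v)"
    using pos_def_coercive by blast
  obtain n where "inverse (real (Suc n)) < e" using reals_Archimedean[OF e(1)] by blast
  then have "(norm v)\<^sup>2 / real (Suc n) \<le> v \<bullet> (A *v v)" for v
    by (intro order_trans[OF _ e(2)]) (simp add: divide_inverse mult.commute[of "(norm v)\<^sup>2"] mult_right_mono)
  then show ?r using A by (auto simp: pos_def_iff)
next
  assume ?r
  then obtain n where "hermitian A" "\<forall>v. (norm v)\<^sup>2 / real (Suc n) \<le> v \<bullet> (A *v v)" by blast
  then show ?l by (intro inner_lower_bound_pos_def[of A "1 / real (Suc n)"]) auto
qed

lemma pos_def_borel [measurable]: "{X :: complex^'n^'n. pos_def X} \<in> sets borel"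
proof -
  have 1: "{X :: complex^'n^'n. hermitian X} \<in> sets borel"
    by (intro borel_closed closed_hermitian)
  have 2: "{X :: complex^'n^'n. \<forall>v. (norm v)\<^sup>2 / real (Suc n) \<le> v \<bullet> (X *v v)} \<in> sets borel" for n
    by (intro borel_closed closed_Collect_all closed_Collect_le continuous_intros continuous_on_matrix_mult_vec)
  have "{X :: complex^'n^'n. pos_def X} = {X. hermitian X} \<inter>
      (\<Union>n. {X. \<forall>v. (norm v)\<^sup>2 / real (Suc n) \<le> v \<bullet> (X *v v)})"
    by (auto simp: pos_def_iff_coercive)
  also have "\<dots> \<in> sets borel" using 1 2 by blast
  finally show ?thesis .
qed

lemma continuous_on_det: "continuous_on S (\<lambda>A. det (A :: complex^'n^'n))"
  unfolding det_def by (intro continuous_intros)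

lemma trace_measurable [measurable]: "trace \<in> borel_measurable (borel :: (complex^'n^'n) measure)"
  unfolding trace_def[abs_def] by (intro borel_measurable_continuous_onI continuous_intros)

lemma abs_det_powr_measurable [measurable]:
  "(\<lambda>X :: complex^'n^'n. abs_det X powr s) \<in> borel_measurable borel"
proof -
  have [measurable]: "det \<in> borel_measurable (borel :: (complex^'n^'n) measure)"
    by (intro borel_measurable_continuous_onI continuous_on_det)
  have "abs_det X powr s = (if det X = 0 then 0 else exp (s * of_real (ln (cmod (det X)))))" for X :: "complex^'n^'n"
    by (simp add: abs_det_def powr_def Ln_of_real)
  then show ?thesis by simp
qed

section \<open>Schur complements in coordinates\<close>

definition herm_entry :: "('n::linorder \<times> 'n::linorder \<Rightarrow> real) \<Rightarrow> 'n::linorder \<Rightarrow> 'n::linorder \<Rightarrow> complex" where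
  "herm_entry x i j = (if i < j then Complex (x (i, j)) (x (j, i))
     else if i = j then Complex (x (i, i)) 0 else Complex (x (j, i)) (- x (i, j)))"

text \<open>
  Padding the block with an identity keeps matrices of all orders in one type, which allows induction
  on the order, and changes neither the determinant nor positive definiteness.
\<close>

definition herm_block :: "'n::{finite,linorder} set \<Rightarrow> ('n::{finite,linorder} \<times> 'n::{finite,linorder} \<Rightarrow> real) \<Rightarrow> 'n::{finite,linorder} cmatrix" where
  "herm_block I x = (\<chi> i j. if i \<in> I \<and> j \<in> I then herm_entry x i j else of_bool (i = j))"

definition herm_coords :: "'n::{finite,linorder} cmatrix \<Rightarrow> 'n::{finite,linorder} \<times> 'n::{finite,linorder} \<Rightarrow> real" where
  "herm_coords A = (\<lambda>(i, j). if i \<le> j then Re (A $ i $ j) else Im (A $ j $ i))"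

lemma herm_entry_cnj: "herm_entry x j i = cnj (herm_entry x i j)"
  by (auto simp: herm_entry_def complex_eq_iff)

lemma herm_entry_diff: "herm_entry (\<lambda>e. x e - y e) i j = herm_entry x i j - herm_entry y i j"
  by (auto simp: herm_entry_def complex_eq_iff)

lemma herm_entry_cong:
  "x (i, j) = y (i, j) \<Longrightarrow> x (j, i) = y (j, i) \<Longrightarrow> herm_entry x i j = herm_entry y i j"
  by (auto simp: herm_entry_def)

lemma herm_block_cong:
  "(\<And>e. e \<in> I \<times> I \<Longrightarrow> x e = y e) \<Longrightarrow> herm_block I x = herm_block I y"
  by (auto simp: herm_block_def vec_eq_iff intro!: herm_entry_cong)

lemma hermitian_cnj: "hermitian A \<Longrightarrow> A $ j $ i = cnj (A $ i $ j)"
  unfolding hermitian_def conj_transpose_def by (metis vec_lambda_beta)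

lemma herm_entry_coords:
  assumes "hermitian A" shows "herm_entry (herm_coords A) i j = A $ i $ j"
proof -
  have "Im (A $ i $ i) = 0" using hermitian_cnj[OF assms, of i i] by (simp add: complex_eq_iff)
  then show ?thesis
    using hermitian_cnj[OF assms, of j i] by (auto simp: herm_entry_def herm_coords_def complex_eq_iff)
qed

lemma herm_block_UNIV_coords: "hermitian A \<Longrightarrow> herm_block UNIV (herm_coords A) = A"
  by (simp add: herm_block_def herm_entry_coords vec_eq_iff)

lemma herm_block_empty: "herm_block {} x = mat 1"
  by (simp add: herm_block_def mat_def vec_eq_iff)

lemma herm_of_eq_block: "herm_of x = herm_block UNIV (\<lambda>(i, j). x $ i $ j)"
  by (auto simp: herm_of_def herm_block_def herm_entry_def vec_eq_iff)

lemma hermitian_herm_block: "hermitian (herm_block I x)"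
  by (auto simp: hermitian_def conj_transpose_def herm_block_def vec_eq_iff herm_entry_cnj[symmetric])

lemma hermitian_herm_of: "hermitian (herm_of x)"
  by (simp add: herm_of_eq_block hermitian_herm_block)

lemma Re_trace_herm_block:
  "Re (trace (herm_block I x)) = (\<Sum>i\<in>I. x (i, i)) + real (card (- I))"
proof -
  have "Re (trace (herm_block I x)) = (\<Sum>i\<in>UNIV. if i \<in> I then x (i, i) else 1)"
    by (auto simp: trace_def herm_block_def herm_entry_def intro!: sum.cong)
  also have "\<dots> = (\<Sum>i\<in>I. x (i, i)) + real (card (- I))"
    by (simp add: sum.If_cases)
  finally show ?thesis .
qed

lemma trace_herm_block_UNIV: "trace (herm_block UNIV x) = of_real (\<Sum>i\<in>UNIV. x (i, i))"
  by (auto simp: trace_def herm_block_def herm_entry_def complex_eq_iff)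

definition unit_column :: "'n \<Rightarrow> complex^'n \<Rightarrow> complex^'n^'n" where
  "unit_column k v = (\<chi> i j. if i = j then 1 else if j = k then v $ i else 0)"

definition scale_axis :: "'n \<Rightarrow> real \<Rightarrow> complex^'n^'n" where
  "scale_axis k a = (\<chi> i j. if i = j then if i = k then of_real a else 1 else 0)"

lemma unit_column_mult:
  "(unit_column k v ** A) $ i $ j = A $ i $ j + (if i = k then 0 else v $ i * A $ k $ j)"
proof -
  have "(unit_column k v ** A) $ i $ j
      = (\<Sum>l\<in>UNIV. (if l = i then A $ i $ j else 0) + (if l = k then if i = k then 0 else v $ i * A $ k $ j else 0))"
    by (simp only: matrix_matrix_mult_def vec_lambda_beta, rule sum.cong) (auto simp: unit_column_def)
  then show ?thesis by (simp add: sum.distrib)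
qed

lemma mult_unit_column_adjoint:
  "(A ** conj_transpose (unit_column k v)) $ i $ j = A $ i $ j + (if j = k then 0 else cnj (v $ j) * A $ i $ k)"
proof -
  have "(A ** conj_transpose (unit_column k v)) $ i $ j
      = (\<Sum>l\<in>UNIV. (if l = j then A $ i $ j else 0) + (if l = k then if j = k then 0 else cnj (v $ j) * A $ i $ k else 0))"
    by (simp only: matrix_matrix_mult_def vec_lambda_beta, rule sum.cong) (auto simp: unit_column_def conj_transpose_def)
  then show ?thesis by (simp add: sum.distrib)
qed

lemma scale_axis_mult:
  "(scale_axis k a ** A) $ i $ j = (if i = k then of_real a else 1) * A $ i $ j"
  by (simp add: matrix_matrix_mult_def scale_axis_def if_distrib[of "\<lambda>x. x * _"] cong: if_cong)

lemma mult_scale_axis: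
  "(A ** scale_axis k a) $ i $ j = (if j = k then of_real a else 1) * A $ i $ j"
proof -
  have "(A ** scale_axis k a) $ i $ j
     = (\<Sum>l\<in>UNIV. if l = j then (if j = k then of_real a else 1) * A $ i $ j else 0)"
    by (simp only: matrix_matrix_mult_def vec_lambda_beta, rule sum.cong) (auto simp: scale_axis_def)
  then show ?thesis by simp
qed

lemma conj_transpose_scale_axis: "conj_transpose (scale_axis k a) = scale_axis k a"
  by (auto simp: conj_transpose_def scale_axis_def vec_eq_iff)

lemma unit_column_add: "unit_column k v ** unit_column k w = unit_column k (v + w)"
  by (auto simp: vec_eq_iff unit_column_mult) (auto simp: unit_column_def)

text \<open>
  Conjugation by the scaling doubles \<open>v\<close>, and so does squaring, because shears along the same column
  form an additive group.
\<close>

lemma scale_axis_conjugate_unit_column: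
  "scale_axis k (1 / 2) ** unit_column k v ** scale_axis k 2 = unit_column k v ** unit_column k v"
  unfolding unit_column_add by (auto simp: vec_eq_iff scale_axis_mult mult_scale_axis) (auto simp: unit_column_def)

lemma det_scale_axis: "det (scale_axis k a) = of_real a"
  by (subst det_diagonal) (auto simp: scale_axis_def)

text \<open>
  Being conjugate to its own square, the shear has determinant 0 or 1, and it is invertible.  The same
  argument computes the Jacobian of the congruence by a shear.
\<close>

lemma det_unit_column: "det (unit_column k v) = 1"
proof -
  have "det (unit_column k v) * det (unit_column k v) = det (unit_column k v)"
    using arg_cong[OF scale_axis_conjugate_unit_column[of k v], of det]
    by (simp add: det_mul det_scale_axis)
  moreover have "unit_column k v ** unit_column k (- v) = mat 1"
    unfolding unit_column_add by (auto simp: unit_column_def mat_def vec_eq_iff)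
  then have "det (unit_column k v) * det (unit_column k (- v)) = 1" by (metis det_I det_mul)
  ultimately show ?thesis by (metis mult_cancel_right1 mult_zero_left zero_neq_one)
qed

text \<open>
  The coordinates of \<open>v v\<^sup>* / a\<close>, where \<open>v\<close> is the column of index \<open>k\<close> and \<open>a\<close> its diagonal entry: subtracting
  them from the coordinates of the block gives the Schur complement.
\<close>

definition schur_shift :: "'n::{finite,linorder} \<Rightarrow> ('n::{finite,linorder} \<times> 'n::{finite,linorder} \<Rightarrow> real) \<Rightarrow> 'n::{finite,linorder} \<times> 'n::{finite,linorder} \<Rightarrow> real" where
  "schur_shift k x = herm_coords (\<chi> i j. herm_entry x i k * cnj (herm_entry x j k) / of_real (x (k, k)))"

definition schur_factor :: "'n::{finite,linorder} set \<Rightarrow> 'n::{finite,linorder} \<Rightarrow> ('n::{finite,linorder} \<times> 'n::{finite,linorder} \<Rightarrow> real) \<Rightarrow> 'n::{finite,linorder} cmatrix" where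
  "schur_factor I k x = unit_column k (\<chi> i. if i \<in> I then herm_entry x i k / of_real (x (k, k)) else 0)
     ** scale_axis k (sqrt (x (k, k)))"

lemma det_schur_factor: "det (schur_factor I k x) = of_real (sqrt (x (k, k)))"
  by (simp add: schur_factor_def det_mul det_unit_column det_scale_axis)

lemma herm_entry_schur_shift:
  "herm_entry (schur_shift k x) i j = herm_entry x i k * cnj (herm_entry x j k) / of_real (x (k, k))"
  unfolding schur_shift_def by (subst herm_entry_coords) (auto simp: hermitian_def conj_transpose_def vec_eq_iff)

text \<open>
  Block elimination of the index \<open>k\<close>.  As a congruence it controls determinant and positive
  definiteness at once, and the Schur complement depends on the block of \<open>I\<close> by translation only.
\<close>

lemma schur_complement:
  assumes k: "k \<notin> I" and a: "x (k, k) > 0"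
  shows "herm_block (insert k I) x
    = schur_factor I k x ** herm_block I (\<lambda>e. x e - schur_shift k x e) ** conj_transpose (schur_factor I k x)"
proof -
  define a where "a = x (k, k)"
  define u where "u = (\<chi> i. if i \<in> I then herm_entry x i k / of_real a else 0)"
  define Y where "Y = herm_block I (\<lambda>e. x e - schur_shift k x e)"
  have a0: "a > 0" using a by (simp add: a_def)
  define E where "E = scale_axis k (sqrt a) ** Y ** scale_axis k (sqrt a)"
  have sq: "complex_of_real (sqrt a) * complex_of_real (sqrt a) = of_real a"
    using a0 by (simp flip: of_real_mult)
  have E: "E $ i $ j = (if i = k \<and> j = k then of_real a else Y $ i $ j)" for i j
    using k by (auto simp: E_def scale_axis_mult mult_scale_axis Y_def herm_block_def sq)
  have "schur_factor I k x ** Y ** conj_transpose (schur_factor I k x)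
     = unit_column k u ** E ** conj_transpose (unit_column k u)"
    unfolding schur_factor_def E_def u_def a_def
    by (simp add: conj_transpose_mult conj_transpose_scale_axis matrix_mul_assoc)
  moreover have "(unit_column k u ** E ** conj_transpose (unit_column k u)) $ i $ j = herm_block (insert k I) x $ i $ j" for i j
  proof -
    have Yk: "Y $ i $ k = of_bool (i = k)" "Y $ k $ j = of_bool (k = j)" for i j
      using k by (auto simp: Y_def herm_block_def)
    have Yij: "Y $ i $ j = herm_entry x i j - herm_entry x i k * cnj (herm_entry x j k) / of_real a"
      if "i \<in> I" "j \<in> I" for i j
      using that by (simp add: Y_def herm_block_def herm_entry_diff herm_entry_schur_shift a_def)
    have Yo: "Y $ i $ j = of_bool (i = j)" if "i \<notin> I \<or> j \<notin> I" for i j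
      using that by (auto simp: Y_def herm_block_def)
    have kk: "herm_entry x k k = of_real a" by (simp add: herm_entry_def a_def complex_eq_iff)
    have "(unit_column k u ** E ** conj_transpose (unit_column k u)) $ i $ j
       = E $ i $ j + (if i = k then 0 else u $ i * E $ k $ j)
         + (if j = k then 0 else cnj (u $ j) * (E $ i $ k + (if i = k then 0 else u $ i * E $ k $ k)))"
      by (simp add: unit_column_mult mult_unit_column_adjoint)
    also have "\<dots> = herm_block (insert k I) x $ i $ j"
    proof (cases "i = k")
      case True
      then show ?thesis
        using k a0 by (auto simp: E Yk herm_block_def kk u_def herm_entry_cnj[symmetric])
    next
      case False
      then show ?thesis
        using k a0 by (auto simp: E Yk Yij Yo herm_block_def u_def)
    qed
    finally show ?thesis .
  qed
  ultimately show ?thesis by (simp add: vec_eq_iff Y_def)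
qed

lemma pos_def_diag_pos:
  assumes "pos_def (A :: complex^'n^'n)" shows "0 < Re (A $ k $ k)"
proof -
  have "0 < axis k 1 \<bullet> (A *v axis k 1)"
    by (rule pos_def_inner_pos[OF assms]) simp
  also have "\<dots> = Re ((A *v axis k 1) $ k)" by (simp add: inner_axis' inner_complex_def)
  also have "\<dots> = Re (A $ k $ k)"
    by (simp add: matrix_vector_mult_def axis_def if_distrib[of "\<lambda>x. _ * x"] cong: if_cong)
  finally show ?thesis .
qed

text \<open>
  A diagonal entry of a positive definite matrix is positive; given that, the Schur complement is
  congruent to the whole block.
\<close>

lemma pos_def_herm_block_insert:
  assumes k: "k \<notin> I"
  shows "pos_def (herm_block (insert k I) x)
    \<longleftrightarrow> 0 < x (k, k) \<and> pos_def (herm_block I (\<lambda>e. x e - schur_shift k x e))"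
proof (cases "0 < x (k, k)")
  case True
  then show ?thesis
    unfolding schur_complement[of k I x, OF k True]
    by (subst pos_def_congruence) (auto simp: det_schur_factor)
next
  case False
  then show ?thesis
    using pos_def_diag_pos[of "herm_block (insert k I) x" k] by (auto simp: herm_block_def herm_entry_def)
qed

lemma cmod_det_herm_block_insert:
  assumes k: "k \<notin> I" and a: "x (k, k) > 0"
  shows "cmod (det (herm_block (insert k I) x))
    = x (k, k) * cmod (det (herm_block I (\<lambda>e. x e - schur_shift k x e)))"
proof -
  have "sqrt (x (k, k)) * sqrt (x (k, k)) = x (k, k)" using a by simp
  then show ?thesis
    unfolding schur_complement[of k I x, OF k a]
    using a by (simp add: det_mul det_conj_transpose det_schur_factor norm_mult mult.commute mult.left_commute)
qed

section \<open>Lebesgue measure in coordinates\<close>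

interpretation lborel_prod: product_sigma_finite "\<lambda>_. lborel :: real measure"
  by standard

lemma distr_PiM_lborel_shift:
  assumes "finite J"
  shows "distr (PiM J (\<lambda>_. lborel)) (PiM J (\<lambda>_. lborel)) (\<lambda>x. \<lambda>e\<in>J. x e - w e :: real) = PiM J (\<lambda>_. lborel)"
proof (rule lborel_prod.PiM_eqI[OF assms])
  fix A :: "'a \<Rightarrow> real set" assume A: "\<And>i. i \<in> J \<Longrightarrow> A i \<in> sets lborel"
  have meas: "(\<lambda>x. \<lambda>e\<in>J. x e - w e) \<in> PiM J (\<lambda>_. lborel) \<rightarrow>\<^sub>M PiM J (\<lambda>_. lborel)"
    by measurable
  have vim: "(\<lambda>x. \<lambda>e\<in>J. x e - w e) -` (Pi\<^sub>E J A) \<inter> space (PiM J (\<lambda>_. lborel)) = Pi\<^sub>E J (\<lambda>e. (\<lambda>t. t - w e) -` A e)"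
    by (auto simp: space_PiM PiE_iff)
  have sh: "(\<lambda>t. t - w e) -` A e \<in> sets lborel" "emeasure lborel ((\<lambda>t. t - w e) -` A e) = emeasure lborel (A e)" if "e \<in> J" for e
  proof -
    have m: "(\<lambda>t. t - w e) \<in> borel_measurable lborel" by measurable
    show "(\<lambda>t. t - w e) -` A e \<in> sets lborel"
      using measurable_sets[OF m, of "A e"] A[OF that] by simp
    have "emeasure lborel (A e) = emeasure (distr lborel borel ((+) (- w e))) (A e)"
      by (simp add: lborel_distr_plus)
    also have "\<dots> = emeasure lborel ((\<lambda>t. t - w e) -` A e)"
      using A[OF that] by (subst emeasure_distr) (auto intro!: arg_cong[where f = "emeasure lborel"])
    finally show "emeasure lborel ((\<lambda>t. t - w e) -` A e) = emeasure lborel (A e)" by simp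
  qed
  show "emeasure (distr (PiM J (\<lambda>_. lborel)) (PiM J (\<lambda>_. lborel)) (\<lambda>x. \<lambda>e\<in>J. x e - w e)) (Pi\<^sub>E J A)
      = (\<Prod>i\<in>J. emeasure lborel (A i))"
    using A assms sh by (subst emeasure_distr[OF meas]) (auto simp: vim lborel_prod.emeasure_PiM)
qed simp

lemma Basis_matrix: "(Basis :: (real^'n^'m) set) = (\<lambda>(i, j). axis i (axis j 1)) ` UNIV"
  by (auto simp: Basis_vec_def)

lemma prod_Basis_matrix:
  fixes f :: "real^'n^'m \<Rightarrow> 'c::comm_monoid_mult"
  shows "(\<Prod>b\<in>Basis. f b) = (\<Prod>i\<in>UNIV. \<Prod>j\<in>UNIV. f (axis i (axis j 1)))"
proof -
  have inj: "inj (\<lambda>(i, j). axis i (axis j 1) :: real^'n^'m)"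
    by (auto simp: inj_def axis_eq_axis)
  show ?thesis
    unfolding Basis_matrix by (subst prod.reindex[OF inj]) (simp add: prod.cartesian_product case_prod_beta')
qed

lemma lborel_matrix_eq_distr_PiM:
  "distr (PiM UNIV (\<lambda>_. lborel)) borel (\<lambda>x. \<chi> i j. x (i, j)) = (lborel :: (real^'n^'m) measure)"
proof (rule lborel_eqI[symmetric])
  fix l u :: "real^'n^'m"
  assume le: "\<And>b. b \<in> Basis \<Longrightarrow> l \<bullet> b \<le> u \<bullet> b"
  have le': "l $ i $ j \<le> u $ i $ j" for i j
    using le[of "axis i (axis j 1)"] by (simp add: inner_axis axis_in_Basis_iff)
  have meas: "(\<lambda>x. \<chi> i j. x (i, j)) \<in> PiM (UNIV :: ('m \<times> 'n) set) (\<lambda>_. lborel) \<rightarrow>\<^sub>M (borel :: (real^'n^'m) measure)"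
    unfolding borel_measurable_euclidean_space[where f = "\<lambda>x. \<chi> i j. x (i, j)"]
    by (auto simp: Basis_vec_def inner_axis)
  have vim: "(\<lambda>x. \<chi> i j. x (i, j)) -` box l u \<inter> space (PiM UNIV (\<lambda>_. lborel))
      = (\<Pi>\<^sub>E e\<in>UNIV. {l $ fst e $ snd e <..< u $ fst e $ snd e})"
    by (auto simp: space_PiM mem_box_cart box_eq_empty mem_box Basis_vec_def inner_axis PiE_iff)
  have "emeasure (distr (PiM UNIV (\<lambda>_. lborel)) borel (\<lambda>x. \<chi> i j. x (i, j))) (box l u)
     = (\<Prod>e\<in>UNIV. emeasure lborel {l $ fst e $ snd e <..< u $ fst e $ snd e})"
    by (subst emeasure_distr[OF meas]) (auto simp: vim lborel_prod.emeasure_PiM)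
  also have "\<dots> = (\<Prod>e\<in>UNIV. ennreal (u $ fst e $ snd e - l $ fst e $ snd e))"
    using le' by (intro prod.cong) auto
  also have "\<dots> = ennreal (\<Prod>e\<in>UNIV. u $ fst e $ snd e - l $ fst e $ snd e)"
    using le' by (intro prod_ennreal) auto
  also have "(\<Prod>e\<in>UNIV. u $ fst e $ snd e - l $ fst e $ snd e) = (\<Prod>b\<in>Basis. (u - l) \<bullet> b)"
    by (simp add: prod_Basis_matrix prod.cartesian_product inner_axis case_prod_beta')
  finally show "emeasure (distr (PiM UNIV (\<lambda>_. lborel)) borel (\<lambda>x. \<chi> i j. x (i, j))) (box l u)
     = ennreal (\<Prod>b\<in>Basis. (u - l) \<bullet> b)" .
qed simp

lemma borel_measurable_matrix:
  fixes f :: "'a \<Rightarrow> 'c::euclidean_space^'n^'m"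
  assumes "\<And>i j. (\<lambda>x. f x $ i $ j) \<in> borel_measurable M"
  shows "f \<in> borel_measurable M"
  unfolding borel_measurable_euclidean_space[where f = f]
  using assms by (auto simp: Basis_vec_def inner_axis)

lemma herm_block_measurable:
  assumes "I \<times> I \<subseteq> J"
  shows "herm_block I \<in> PiM J (\<lambda>_. lborel) \<rightarrow>\<^sub>M borel"
proof (rule borel_measurable_matrix)
  fix i j
  have [measurable]: "(\<lambda>x. x e) \<in> borel_measurable (PiM J (\<lambda>_. lborel :: real measure))" if "e \<in> I \<times> I" for e
    using measurable_component_singleton[of e J "\<lambda>_. lborel"] assms that by auto
  show "(\<lambda>x. herm_block I x $ i $ j) \<in> borel_measurable (PiM J (\<lambda>_. lborel))"
    unfolding herm_block_def herm_entry_def Complex_eq by (cases "i \<in> I \<and> j \<in> I") auto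
qed

lemma herm_of_measurable [measurable]:
  "(herm_of :: real^'n::{finite,linorder}^'n::{finite,linorder} \<Rightarrow> _) \<in> borel_measurable borel"
proof (rule borel_measurable_matrix)
  fix i j :: "'n::{finite,linorder}"
  have [measurable]: "(\<lambda>x :: real^'n::{finite,linorder}^'n::{finite,linorder}. x $ i $ j) \<in> borel_measurable borel" for i j
    by (intro borel_measurable_continuous_onI continuous_intros)
  show "(\<lambda>x. herm_of x $ i $ j) \<in> borel_measurable borel"
    unfolding herm_of_def Complex_eq by auto
qed

lemma herm_lborel_eq_distr_PiM:
  "herm_lborel = distr (PiM UNIV (\<lambda>_. lborel)) borel (herm_block (UNIV :: 'n::{finite,linorder} set))"
proof -
  have [measurable]: "(\<lambda>x. \<chi> i j. x (i, j)) \<in> PiM (UNIV :: ('n::{finite,linorder} \<times> 'n::{finite,linorder}) set) (\<lambda>_. lborel) \<rightarrow>\<^sub>M (borel :: (real^'n::{finite,linorder}^'n::{finite,linorder}) measure)"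
    by (rule borel_measurable_matrix) auto
  show ?thesis
    unfolding herm_lborel_def lborel_matrix_eq_distr_PiM[symmetric]
    by (subst distr_distr) (auto simp: comp_def herm_of_eq_block)
qed

lemma sets_herm_lborel [simp, measurable_cong]: "sets herm_lborel = sets borel"
  by (simp add: herm_lborel_def)

section \<open>Integrability\<close>

text \<open>
  The scalar gamma integral at \<open>z = 1\<close>, once for each half-line.
\<close>

lemma integrable_exp_neg_abs:
  assumes "c > 0" shows "integrable lborel (\<lambda>t :: real. exp (- c * \<bar>t\<bar>))"
proof -
  have "set_integrable lebesgue {0<..} (\<lambda>t. complex_of_real t powr (1 - 1) / of_real (exp (c * t)))"
    using absolutely_integrable_Gamma_integral[of 1 c] assms by simp
  then have "set_integrable lebesgue {0<..} (\<lambda>t. exp (- c * t))"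
    unfolding set_integrable_def
    by (rule Bochner_Integration.integrable_bound)
      (auto simp: indicator_def norm_divide norm_inverse exp_minus divide_inverse simp del: of_real_exp intro!: borel_measurable_if_I measurable_completion)
  then have 1: "integrable lborel (\<lambda>t. indicator {0<..} t *\<^sub>R exp (- c * t))"
    unfolding set_integrable_def by (subst (asm) integrable_completion) auto
  have 2: "integrable lborel (\<lambda>t. indicator {0<..} (- t) *\<^sub>R exp (c * t))"
    using lborel_integrable_real_affine[OF 1, of "-1" 0] by simp
  show ?thesis
  proof (rule Bochner_Integration.integrable_bound[OF Bochner_Integration.integrable_add[OF 1 2]])
    show "AE t in lborel. norm (exp (- c * \<bar>t\<bar>))
        \<le> norm (indicator {0<..} t *\<^sub>R exp (- c * t) + indicator {0<..} (- t) *\<^sub>R exp (c * t))"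
      using AE_lborel_singleton[of "0::real"] by eventually_elim (auto simp: indicator_def)
  qed auto
qed

lemma integrable_PiM_exp_bound:
  fixes f :: "('i \<Rightarrow> real) \<Rightarrow> 'b::{banach,second_countable_topology}"
  assumes J: "finite J" and [measurable]: "f \<in> borel_measurable (PiM J (\<lambda>_. lborel))" and c: "c > 0"
    and bound: "\<And>x. x \<in> space (PiM J (\<lambda>_. lborel :: real measure)) \<Longrightarrow> norm (f x) \<le> C * exp (- c * (\<Sum>e\<in>J. \<bar>x e\<bar>))"
  shows "integrable (PiM J (\<lambda>_. lborel)) f"
proof (rule Bochner_Integration.integrable_bound)
  show "integrable (PiM J (\<lambda>_. lborel)) (\<lambda>x. C * (\<Prod>e\<in>J. exp (- c * \<bar>x e\<bar>)))"
    by (intro integrable_mult_right lborel_prod.product_integrable_prod J integrable_exp_neg_abs c)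
  show "AE x in PiM J (\<lambda>_. lborel). norm (f x) \<le> norm (C * (\<Prod>e\<in>J. exp (- c * \<bar>x e\<bar>)))"
  proof (rule AE_I2)
    fix x assume x: "x \<in> space (PiM J (\<lambda>_. lborel :: real measure))"
    have "exp (- c * (\<Sum>e\<in>J. \<bar>x e\<bar>)) = (\<Prod>e\<in>J. exp (- c * \<bar>x e\<bar>))"
      using J by (simp add: exp_sum sum_distrib_left flip: sum_negf)
    then have "norm (f x) \<le> C * (\<Prod>e\<in>J. exp (- c * \<bar>x e\<bar>))"
      using bound[OF x] by simp
    then show "norm (f x) \<le> norm (C * (\<Prod>e\<in>J. exp (- c * \<bar>x e\<bar>)))"
      by (simp only: real_norm_def)
  qed
qed (rule assms)

lemma abs_coord_le_trace:
  assumes pd: "pos_def (herm_block I x)" and e: "e \<in> I \<times> I"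
  shows "\<bar>x e\<bar> \<le> Re (trace (herm_block I x))"
proof -
  obtain i j where ij: "e = (i, j)" "i \<in> I" "j \<in> I" using e by auto
  have "\<bar>x (i, j)\<bar> \<le> cmod (herm_entry x i j) \<or> \<bar>x (i, j)\<bar> \<le> cmod (herm_entry x j i)"
    using abs_Re_le_cmod[of "herm_entry x i j"] abs_Im_le_cmod[of "herm_entry x i j"]
    by (auto simp: herm_entry_def)
  then show ?thesis
    using pos_def_entry_le_trace[OF pd, of i j] pos_def_entry_le_trace[OF pd, of j i] ij
    by (auto simp: herm_block_def)
qed

text \<open>
  On the cone every coordinate is bounded by the trace, so decay in the trace is decay in all
  coordinates, which is integrable over the whole coordinate space.
\<close>

lemma integrable_pos_def_exp_bound:
  fixes g :: "'n::{finite,linorder} cmatrix \<Rightarrow> complex"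
  assumes [measurable]: "g \<in> borel_measurable borel" and e: "e > 0"
    and bound: "\<And>Z. pos_def Z \<Longrightarrow> cmod (g Z) \<le> C * exp (- e * Re (trace Z))"
  shows "integrable (PiM (I \<times> I) (\<lambda>_. lborel)) (\<lambda>x. indicator {Z. pos_def Z} (herm_block I x) *\<^sub>R g (herm_block I x))"
proof (rule integrable_PiM_exp_bound)
  note herm_block_measurable[of I "I \<times> I", measurable]
  define N where "N = real (card (I \<times> I)) + 1"
  have N: "N > 0" unfolding N_def by (rule add_nonneg_pos) auto
  show "(\<lambda>x. indicator {Z. pos_def Z} (herm_block I x) *\<^sub>R g (herm_block I x)) \<in> borel_measurable (PiM (I \<times> I) (\<lambda>_. lborel))"
    by measurable
  show "e / N > 0" using e N by simp
  have C: "0 \<le> C"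
  proof -
    have "0 \<le> C * exp (- e * Re (trace (mat 1 :: 'n cmatrix)))"
      using bound[OF pos_def_mat_1] norm_ge_zero order_trans by blast
    then show ?thesis by (simp add: zero_le_mult_iff)
  qed
  fix x
  show "norm (indicator {Z. pos_def Z} (herm_block I x) *\<^sub>R g (herm_block I x)) \<le> C * exp (- (e / N) * (\<Sum>e\<in>I \<times> I. \<bar>x e\<bar>))"
  proof (cases "pos_def (herm_block I x)")
    case True
    define t where "t = Re (trace (herm_block I x))"
    have t: "t \<ge> 0" using pos_def_trace_nonneg[OF True] by (simp add: t_def)
    have "(\<Sum>e\<in>I \<times> I. \<bar>x e\<bar>) \<le> (\<Sum>e\<in>I \<times> I. t)"
      unfolding t_def by (intro sum_mono abs_coord_le_trace True)
    also have "\<dots> \<le> N * t" using t by (simp add: N_def algebra_simps)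
    finally have "e / N * (\<Sum>e\<in>I \<times> I. \<bar>x e\<bar>) \<le> e / N * (N * t)" using e N by (intro mult_left_mono) auto
    then have "exp (- e * t) \<le> exp (- (e / N) * (\<Sum>e\<in>I \<times> I. \<bar>x e\<bar>))" using N by simp
    then have "C * exp (- e * t) \<le> C * exp (- (e / N) * (\<Sum>e\<in>I \<times> I. \<bar>x e\<bar>))"
      using C by (rule mult_left_mono)
    then show ?thesis using bound[OF True] True by (simp add: t_def)
  qed (use C in simp)
qed simp

section \<open>The matrix gamma function does not vanish\<close>

text \<open>
  The gamma integrand of the block with the argument shifted: \<open>s\<close> is the exponent of the determinant, so
  that it stays the same when an index is added.
\<close>

definition block_integrand :: "complex \<Rightarrow> 'n::{finite,linorder} set \<Rightarrow> ('n::{finite,linorder} \<times> 'n::{finite,linorder} \<Rightarrow> real) \<Rightarrow> complex" where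
  "block_integrand s I x = (if pos_def (herm_block I x)
     then abs_det (herm_block I x) powr s * of_real (exp (- (\<Sum>i\<in>I. x (i, i)))) else 0)"

definition block_Gamma :: "complex \<Rightarrow> 'n::{finite,linorder} set \<Rightarrow> complex" where
  "block_Gamma s I = (LINT x|PiM (I \<times> I) (\<lambda>_. lborel). block_integrand s I x)"

lemma integrable_block_integrand:
  assumes "0 \<le> Re s"
  shows "integrable (PiM (I \<times> I) (\<lambda>_. lborel)) (block_integrand s (I :: 'n::{finite,linorder} set))"
proof -
  define K where "K = exp (real (card (- I)))"
  define g where "g Z = abs_det Z powr s * of_real (exp (- Re (trace Z)) * K)" for Z :: "'n::{finite,linorder} cmatrix"
  obtain C e where Ce: "C \<ge> 0" "e > 0"
    "\<And>Z :: 'n::{finite,linorder} cmatrix. pos_def Z \<Longrightarrow>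
       cmod (abs_det Z powr s * abs_det (mat 1 + Z) powr 0 * exp (- trace (mat 1 ** Z))) \<le> C * exp (- e * Re (trace Z))"
    using pos_def_integrand_bound[OF pos_def_mat_1 assms, of 0] by metis
  have "cmod (g Z) \<le> (C * K) * exp (- e * Re (trace Z))" if Z: "pos_def Z" for Z
  proof -
    have "det (mat 1 + Z) \<noteq> 0" by (intro pos_def_det_nonzero pos_def_add pos_def_mat_1 Z)
    then have "cmod (abs_det Z powr s) * exp (- Re (trace Z)) \<le> C * exp (- e * Re (trace Z))"
      using Ce(3)[OF Z] by (simp add: norm_mult abs_det_def powr_def)
    then have "K * (cmod (abs_det Z powr s) * exp (- Re (trace Z))) \<le> K * (C * exp (- e * Re (trace Z)))"
      by (intro mult_left_mono) (simp_all add: K_def)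
    then show ?thesis by (simp add: g_def norm_mult K_def mult_ac)
  qed
  moreover have "g \<in> borel_measurable borel" unfolding g_def by measurable
  ultimately have "integrable (PiM (I \<times> I) (\<lambda>_. lborel)) (\<lambda>x. indicator {Z. pos_def Z} (herm_block I x) *\<^sub>R g (herm_block I x))"
    by (intro integrable_pos_def_exp_bound[OF _ Ce(2)])
  moreover have "indicator {Z. pos_def Z} (herm_block I x) *\<^sub>R g (herm_block I x) = block_integrand s I x" for x
    by (simp add: block_integrand_def g_def Re_trace_herm_block K_def mult_exp_exp indicator_def)
  ultimately show ?thesis by simp
qed

definition gauss_integral :: real where "gauss_integral = (LBINT t. exp (- t\<^sup>2))"

lemma integrable_gaussian: "integrable lborel (\<lambda>t :: real. exp (- t\<^sup>2))"
proof (rule Bochner_Integration.integrable_bound)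
  show "integrable lborel (\<lambda>t :: real. exp 1 * exp (- 1 * \<bar>t\<bar>))"
    by (intro integrable_mult_right integrable_exp_neg_abs) simp
  have "\<bar>t\<bar> \<le> 1 + t\<^sup>2" for t :: real
    using zero_le_power2[of "\<bar>t\<bar> - 1"] zero_le_power2[of t] by (simp add: power2_diff)
  then show "AE t :: real in lborel. norm (exp (- t\<^sup>2)) \<le> norm (exp 1 * exp (- 1 * \<bar>t\<bar>))"
    by (intro AE_I2) (simp add: mult_exp_exp algebra_simps)
qed auto

lemma gauss_integral_pos: "gauss_integral > 0"
proof -
  have "gauss_integral \<noteq> 0"
  proof
    assume "gauss_integral = 0"
    then have "AE t :: real in lborel. exp (- t\<^sup>2) = (0 :: real)"
      unfolding gauss_integral_def by (subst (asm) integral_nonneg_eq_0_iff_AE[OF integrable_gaussian]) auto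
    then have "AE t :: real in lborel. False" by simp
    then show False by (simp add: eventually_False ae_filter_eq_bot_iff)
  qed
  moreover have "gauss_integral \<ge> 0" unfolding gauss_integral_def by simp
  ultimately show ?thesis by simp
qed

lemma gauss_integral_scaled:
  assumes "a > 0"
  shows "integrable lborel (\<lambda>t :: real. complex_of_real (exp (- (t\<^sup>2 / a))))"
    and "(LBINT t. complex_of_real (exp (- (t\<^sup>2 / a)))) = of_real (sqrt a * gauss_integral)"
proof -
  have a: "1 / sqrt a \<noteq> 0" using assms by simp
  have *: "(0 + 1 / sqrt a * t)\<^sup>2 = t\<^sup>2 / a" for t using assms by (simp add: power_divide)
  have "integrable lborel (\<lambda>t :: real. exp (- (t\<^sup>2 / a)))"
    using lborel_integrable_real_affine[OF integrable_gaussian a, of 0] by (simp only: *)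
  then show "integrable lborel (\<lambda>t :: real. complex_of_real (exp (- (t\<^sup>2 / a))))"
    by (rule integrable_of_real)
  have "gauss_integral = (1 / sqrt a) * (LBINT t. exp (- (t\<^sup>2 / a)))"
    unfolding gauss_integral_def using lborel_integral_real_affine[OF a, of "\<lambda>t. exp (- t\<^sup>2)" 0] assms by (simp only: *) simp
  then have "(LBINT t. exp (- (t\<^sup>2 / a))) = sqrt a * gauss_integral" using assms by (simp add: field_simps)
  then show "(LBINT t. complex_of_real (exp (- (t\<^sup>2 / a)))) = of_real (sqrt a * gauss_integral)"
    by (subst integral_complex_of_real) simp
qed

lemma Gamma_integral_lborel:
  assumes "Re z > 0"
  shows "(LBINT t. (if 0 < t then of_real t powr (z - 1) * of_real (exp (- t)) else 0)) = Gamma z"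
proof -
  let ?f = "\<lambda>t. complex_of_real t powr (z - 1) / of_real (exp t)"
  have "(LINT t:{0<..}|lebesgue. ?f t) = Gamma z"
    using set_lebesgue_integral_eq_integral(2)[OF absolutely_integrable_Gamma_integral'[OF assms]]
      Gamma_integral_complex'[OF assms] by (simp add: integral_unique)
  moreover have "(\<lambda>t. indicator {0<..} t *\<^sub>R ?f t) = (\<lambda>t. if 0 < t then of_real t powr (z - 1) * of_real (exp (- t)) else 0)"
    by (auto simp: indicator_def exp_minus divide_inverse)
  moreover have "(\<lambda>t. if 0 < t then complex_of_real t powr (z - 1) * of_real (exp (- t)) else 0) \<in> borel_measurable lborel"
  proof -
    have "(\<lambda>t. if 0 < t then complex_of_real t powr (z - 1) * of_real (exp (- t)) else 0)
       = (\<lambda>t. if 0 < t then exp ((z - 1) * of_real (ln t)) * of_real (exp (- t)) else 0)"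
      by (auto simp: powr_def Ln_of_real)
    then show ?thesis by simp
  qed
  ultimately show ?thesis
    unfolding set_lebesgue_integral_def by (simp add: integral_completion)
qed

text \<open>The coordinates of the new column when the index \<open>k\<close> is added to \<open>I\<close>, without its diagonal entry \<open>(k, k)\<close>.\<close>

definition border :: "'n set \<Rightarrow> 'n \<Rightarrow> ('n \<times> 'n) set" where
  "border I k = I \<times> {k} \<union> {k} \<times> I"

definition border_integrand :: "complex \<Rightarrow> 'n set \<Rightarrow> 'n \<Rightarrow> ('n \<times> 'n \<Rightarrow> real) \<Rightarrow> complex" where
  "border_integrand s I k y = (if 0 < y (k, k) then of_real (y (k, k)) powr s * of_real (exp (- y (k, k)))
     * (\<Prod>e\<in>border I k. of_real (exp (- ((y e)\<^sup>2 / y (k, k))))) else 0)"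

lemma finite_border: "finite I \<Longrightarrow> finite (border I k)"
  by (simp add: border_def)

lemma sum_border:
  assumes "finite I" "k \<notin> I"
  shows "(\<Sum>e\<in>border I k. f e) = (\<Sum>i\<in>I. f (i, k) + f (k, i))"
proof -
  have "(\<Sum>e\<in>border I k. f e) = (\<Sum>e\<in>I \<times> {k}. f e) + (\<Sum>e\<in>{k} \<times> I. f e)"
    unfolding border_def using assms by (intro sum.union_disjoint) auto
  moreover have "(\<Sum>e\<in>I \<times> {k}. f e) = (\<Sum>i\<in>I. f (i, k))" "(\<Sum>e\<in>{k} \<times> I. f e) = (\<Sum>i\<in>I. f (k, i))"
    using sum.cartesian_product[of "\<lambda>i j. f (i, j)" "{k}" I] sum.cartesian_product[of "\<lambda>i j. f (i, j)" I "{k}"] by simp_all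
  ultimately show ?thesis by (simp add: sum.distrib)
qed

lemma card_border: "finite I \<Longrightarrow> k \<notin> I \<Longrightarrow> card (border I k) = 2 * card I"
  using sum_border[of I k "\<lambda>_. 1 :: nat"] by simp

text \<open>
  Determinants multiply, \<open>det X = a det Y\<close> for the Schur complement \<open>Y = X' - v v\<^sup>* / a\<close> of the block \<open>X'\<close>, and
  traces add, \<open>tr X = a + tr Y + \<parallel>v\<parallel>\<^sup>2 / a\<close>.  Hence the integrand factors into a function of the new column and
  a translate of the integrand of the smaller block.
\<close>

lemma block_integrand_insert:
  fixes I :: "'n::{finite,linorder} set"
  assumes k: "k \<notin> I"
  shows "block_integrand s (insert k I) (merge (insert (k, k) (border I k)) (I \<times> I) (y, z))
    = border_integrand s I k y * block_integrand s I (\<lambda>e\<in>I \<times> I. z e - schur_shift k y e)"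
proof -
  define x where "x = merge (insert (k, k) (border I k)) (I \<times> I) (y, z)"
  have disj: "insert (k, k) (border I k) \<inter> (I \<times> I) = {}" using k by (auto simp: border_def)
  have xz: "x e = z e" if "e \<in> I \<times> I" for e using that disj by (auto simp: x_def merge_def)
  have xy: "x (k, k) = y (k, k)" "\<And>i. i \<in> I \<Longrightarrow> x (i, k) = y (i, k)" "\<And>i. i \<in> I \<Longrightarrow> x (k, i) = y (k, i)"
    by (auto simp: x_def merge_def border_def)
  have he: "herm_entry x i k = herm_entry y i k" if "i \<in> I" for i
    using that xy by (intro herm_entry_cong)
  have shift: "schur_shift k x e = schur_shift k y e" if "e \<in> I \<times> I" for e
    using that by (auto simp: schur_shift_def herm_coords_def he xy)
  define z' where "z' = (\<lambda>e\<in>I \<times> I. z e - schur_shift k y e)"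
  have block: "herm_block I (\<lambda>e. x e - schur_shift k x e) = herm_block I z'"
    by (intro herm_block_cong) (simp only: z'_def restrict_apply' xz shift)
  show ?thesis
  proof (cases "0 < y (k, k)")
    case False
    then have "\<not> pos_def (herm_block (insert k I) x)"
      using pos_def_herm_block_insert[OF k, of x] xy by simp
    then show ?thesis using False by (simp add: block_integrand_def border_integrand_def x_def)
  next
    case True
    define a where "a = y (k, k)"
    have a: "a > 0" "x (k, k) = a" "y (k, k) = a" using True xy by (simp_all add: a_def)
    show ?thesis
    proof (cases "pos_def (herm_block I z')")
      case False
      then have "\<not> pos_def (herm_block (insert k I) x)"
        using pos_def_herm_block_insert[OF k, of x] by (simp add: block)
      then show ?thesis using False by (simp add: block_integrand_def x_def z'_def)
    next
      case pd: True
      have pd': "pos_def (herm_block (insert k I) x)"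
        using pos_def_herm_block_insert[OF k, of x] a pd by (simp add: block)
      have "cmod (det (herm_block (insert k I) x)) = a * cmod (det (herm_block I z'))"
        using cmod_det_herm_block_insert[OF k, of x] a by (simp add: block)
      then have det: "abs_det (herm_block (insert k I) x) powr s = of_real a powr s * abs_det (herm_block I z') powr s"
        using a by (simp add: abs_det_def powr_times_real)
      have diag: "schur_shift k y (i, i) = ((y (i, k))\<^sup>2 + (y (k, i))\<^sup>2) / a" if "i \<in> I" for i
        using that k a by (auto simp: schur_shift_def herm_coords_def herm_entry_def complex_mult_cnj power2_eq_square)
      have "(\<Sum>i\<in>insert k I. x (i, i)) = a + (\<Sum>i\<in>I. z (i, i))"
        using k a by (subst sum.insert) (auto simp: xz)
      also have "(\<Sum>i\<in>I. z (i, i)) = (\<Sum>i\<in>I. z' (i, i)) + (\<Sum>i\<in>I. (y (i, k))\<^sup>2 / a + (y (k, i))\<^sup>2 / a)"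
        by (simp add: z'_def diag add_divide_distrib flip: sum.distrib)
      also have "(\<Sum>i\<in>I. (y (i, k))\<^sup>2 / a + (y (k, i))\<^sup>2 / a) = (\<Sum>e\<in>border I k. (y e)\<^sup>2 / a)"
        by (rule sum_border[symmetric]) (use k in auto)
      finally have "exp (- (\<Sum>i\<in>insert k I. x (i, i)))
          = exp (- a) * exp (\<Sum>e\<in>border I k. - ((y e)\<^sup>2 / a)) * exp (- (\<Sum>i\<in>I. z' (i, i)))"
        by (simp add: mult_exp_exp sum_negf algebra_simps)
      also have "exp (\<Sum>e\<in>border I k. - ((y e)\<^sup>2 / a)) = (\<Prod>e\<in>border I k. exp (- ((y e)\<^sup>2 / a)))"
        by (rule exp_sum) (simp add: finite_border)
      finally have tr: "exp (- (\<Sum>i\<in>insert k I. x (i, i)))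
          = exp (- a) * (\<Prod>e\<in>border I k. exp (- ((y e)\<^sup>2 / a))) * exp (- (\<Sum>i\<in>I. z' (i, i)))" .
      have "block_integrand s (insert k I) x = border_integrand s I k y * block_integrand s I z'"
        unfolding block_integrand_def border_integrand_def a(3)
        using pd pd' a(1) by (simp only: det tr if_True of_real_mult of_real_prod mult_ac)
      then show ?thesis by (simp add: x_def z'_def)
    qed
  qed
qed

lemma border_integrand_measurable:
  assumes "k \<notin> I" "finite I"
  shows "border_integrand s I k \<in> borel_measurable (PiM (insert (k, k) (border I k)) (\<lambda>_. lborel))"
proof -
  define K where "K = insert (k, k) (border I k)"
  have [measurable]: "(\<lambda>x. x e) \<in> borel_measurable (PiM K (\<lambda>_. lborel :: real measure))" if "e \<in> K" for e
    using measurable_component_singleton[of e K "\<lambda>_. lborel"] that by simp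
  have kk [measurable]: "(\<lambda>y. y (k, k)) \<in> borel_measurable (PiM K (\<lambda>_. lborel :: real measure))"
    by measurable (simp add: K_def)
  have *: "(\<lambda>y. y e) \<in> borel_measurable (PiM K (\<lambda>_. lborel :: real measure))" if "e \<in> border I k" for e
  proof -
    have "e \<in> K" using that by (simp add: K_def)
    then show ?thesis by measurable
  qed
  have [measurable]: "(\<lambda>y. \<Prod>e\<in>border I k. complex_of_real (exp (- ((y e)\<^sup>2 / y (k, k))))) \<in> borel_measurable (PiM K (\<lambda>_. lborel :: real measure))"
    by (rule borel_measurable_prod, use * in measurable)
  have "border_integrand s I k = (\<lambda>y. if 0 < y (k, k) then exp (s * of_real (ln (y (k, k)))) * of_real (exp (- y (k, k)))
     * (\<Prod>e\<in>border I k. of_real (exp (- ((y e)\<^sup>2 / y (k, k))))) else 0)"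
    by (auto simp: border_integrand_def powr_def Ln_of_real fun_eq_iff)
  then show ?thesis unfolding K_def[symmetric] by simp
qed

text \<open>
  The Gaussian factors are bounded through \<open>t\<^sup>2 / a \<ge> 2 d \<bar>t\<bar> - d\<^sup>2 a\<close>, with \<open>d\<close> so small that a quarter of the
  decay in \<open>a\<close> pays for the errors, another quarter for the power of \<open>a\<close>, and the half that remains is at
  least \<open>2 d a\<close>.
\<close>

lemma integrable_border_integrand:
  assumes k: "k \<notin> I" and fin: "finite I" and s: "0 \<le> Re s"
  shows "integrable (PiM (insert (k, k) (border I k)) (\<lambda>_. lborel)) (border_integrand s I k)"
proof -
  define m where "m = real (card (border I k))"
  define d where "d = 1 / (2 * (m + 2))"
  have m: "m \<ge> 0" by (simp add: m_def)
  have d: "d > 0" "2 * d \<le> 1 / 2" using m by (auto simp: d_def field_simps)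
  have md: "m * d\<^sup>2 \<le> 1 / 4"
  proof -
    have "m * d \<le> 1 / 2" using m by (simp add: d_def field_simps)
    then have "m * d * d \<le> 1 / 2 * (1 / 4)" using d m by (intro mult_mono) auto
    then show ?thesis by (simp add: power2_eq_square)
  qed
  obtain C where C: "C \<ge> 0" "\<And>t. t \<ge> 0 \<Longrightarrow> (1 + t) powr Re s \<le> C * exp (1 / 4 * t)"
    using powr_le_exp[OF s, of "1 / 4"] by auto
  show ?thesis
  proof (rule integrable_PiM_exp_bound)
    show "finite (insert (k, k) (border I k))" using fin by (simp add: finite_border)
    show "border_integrand s I k \<in> borel_measurable (PiM (insert (k, k) (border I k)) (\<lambda>_. lborel))"
      by (rule border_integrand_measurable[OF k fin])
    show "2 * d > 0" using d by simp
    fix y :: "'a \<times> 'a \<Rightarrow> real"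
    show "norm (border_integrand s I k y) \<le> C * exp (- (2 * d) * (\<Sum>e\<in>insert (k, k) (border I k). \<bar>y e\<bar>))"
    proof (cases "0 < y (k, k)")
      case True
      define a where "a = y (k, k)"
      define S where "S = (\<Sum>e\<in>border I k. \<bar>y e\<bar>)"
      have a: "a > 0" using True by (simp add: a_def)
      have amgm: "2 * d * \<bar>t\<bar> - d\<^sup>2 * a \<le> t\<^sup>2 / a" for t
      proof -
        have "0 \<le> (\<bar>t\<bar> - d * a)\<^sup>2" by simp
        then have "(2 * d * \<bar>t\<bar> - d\<^sup>2 * a) * a \<le> t\<^sup>2" by (simp add: power2_eq_square algebra_simps)
        then show ?thesis using a by (simp add: pos_le_divide_eq)
      qed
      have "2 * d * S - (m * d\<^sup>2) * a = (\<Sum>e\<in>border I k. 2 * d * \<bar>y e\<bar> - d\<^sup>2 * a)"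
        by (simp add: S_def m_def sum_subtractf sum_distrib_left)
      also have "\<dots> \<le> (\<Sum>e\<in>border I k. (y e)\<^sup>2 / a)" by (intro sum_mono amgm)
      finally have low: "2 * d * S - (m * d\<^sup>2) * a \<le> (\<Sum>e\<in>border I k. (y e)\<^sup>2 / a)" .
      have "(m * d\<^sup>2) * a \<le> 1 / 4 * a" "2 * d * a \<le> 1 / 2 * a" using md d a by (auto intro!: mult_right_mono)
      with low have key: "a / 4 - a - (\<Sum>e\<in>border I k. (y e)\<^sup>2 / a) \<le> - (2 * d) * (a + S)"
        by (simp add: algebra_simps)
      have notin: "(k, k) \<notin> border I k" using k by (auto simp: border_def)
      have "norm (border_integrand s I k y) = a powr Re s * exp (- a) * (\<Prod>e\<in>border I k. exp (- ((y e)\<^sup>2 / a)))"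
        using a by (simp add: border_integrand_def a_def[symmetric] norm_mult norm_powr_real_powr prod_norm[symmetric] del: of_real_exp)
      also have "(\<Prod>e\<in>border I k. exp (- ((y e)\<^sup>2 / a))) = exp (- (\<Sum>e\<in>border I k. (y e)\<^sup>2 / a))"
        by (simp add: exp_sum finite_border fin flip: sum_negf)
      also have "a powr Re s * exp (- a) * exp (- (\<Sum>e\<in>border I k. (y e)\<^sup>2 / a))
        \<le> (C * exp (1 / 4 * a)) * exp (- a) * exp (- (\<Sum>e\<in>border I k. (y e)\<^sup>2 / a))"
        using C(2)[of a] a s by (intro mult_right_mono order_trans[OF powr_mono2 C(2)]) auto
      also have "\<dots> = C * exp (a / 4 - a - (\<Sum>e\<in>border I k. (y e)\<^sup>2 / a))"
        by (simp add: mult_exp_exp mult.assoc)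
      also have "\<dots> \<le> C * exp (- (2 * d) * (a + S))"
        using key C by (intro mult_left_mono) simp_all
      also have "a + S = (\<Sum>e\<in>insert (k, k) (border I k). \<bar>y e\<bar>)"
        using a fin notin by (simp add: finite_border S_def a_def)
      finally show ?thesis .
    qed (use C in \<open>simp add: border_integrand_def\<close>)
  qed
qed

text \<open>
  For a fixed diagonal entry \<open>a\<close> the inner integral is a product of \<open>2 m\<close> Gaussian integrals of width \<open>sqrt a\<close>, where \<open>m\<close> is the
  size of \<open>I\<close>.  It contributes \<open>a ^ m\<close> to the scalar gamma integral over \<open>a\<close>.
\<close>

lemma integral_border_integrand:
  assumes k: "k \<notin> I" and fin: "finite I" and s: "0 \<le> Re s"
  shows "(LINT y|PiM (insert (k, k) (border I k)) (\<lambda>_. lborel). border_integrand s I k y)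
    = of_real (gauss_integral ^ (2 * card I)) * Gamma (s + of_nat (card I) + 1)"
proof -
  have notin: "(k, k) \<notin> border I k" using k by (auto simp: border_def)
  define g where "g a = (if 0 < a then of_real a powr s * of_real (exp (- a)) * of_real (sqrt a * gauss_integral) ^ (2 * card I) else 0)"
    for a :: real
  have inner: "(LINT z|PiM (border I k) (\<lambda>_. lborel). border_integrand s I k (merge {(k, k)} (border I k) (y, z))) = g (y (k, k))"
    for y :: "'a \<times> 'a \<Rightarrow> real"
  proof -
    define a where "a = y (k, k)"
    have mk: "merge {(k, k)} (border I k) (y, z) (k, k) = a"
      and me: "e \<in> border I k \<Longrightarrow> merge {(k, k)} (border I k) (y, z) e = z e" for z e
      using notin by (auto simp: merge_def a_def)
    have "border_integrand s I k (merge {(k, k)} (border I k) (y, z)) =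
        (if 0 < a then of_real a powr s * of_real (exp (- a)) * (\<Prod>e\<in>border I k. of_real (exp (- ((z e)\<^sup>2 / a)))) else 0)" for z
      unfolding border_integrand_def mk by (simp add: me cong: prod.cong)
    moreover have "(LINT z|PiM (border I k) (\<lambda>_. lborel). (\<Prod>e\<in>border I k. complex_of_real (exp (- ((z e)\<^sup>2 / a)))))
        = of_real (sqrt a * gauss_integral) ^ (2 * card I)" if a: "0 < a"
      using gauss_integral_scaled[OF a] fin k
      by (subst lborel_prod.product_integral_prod) (simp_all add: finite_border card_border)
    ultimately show ?thesis by (simp add: g_def a_def[symmetric])
  qed
  have "(LINT y|PiM (insert (k, k) (border I k)) (\<lambda>_. lborel). border_integrand s I k y)
     = (LINT y|PiM {(k, k)} (\<lambda>_. lborel). LINT z|PiM (border I k) (\<lambda>_. lborel). border_integrand s I k (merge {(k, k)} (border I k) (y, z)))"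
    using lborel_prod.product_integral_fold[of "{(k, k)}" "border I k" "border_integrand s I k"]
      integrable_border_integrand[OF k fin s] notin fin by (simp add: finite_border)
  also have "\<dots> = (LINT y|PiM {(k, k)} (\<lambda>_. lborel). g (y (k, k)))"
    by (simp only: inner)
  also have g: "g a = (if 0 < a then of_real a powr (s + of_nat (card I) + 1 - 1) * of_real (exp (- a)) else 0) * of_real (gauss_integral ^ (2 * card I))" for a
  proof (cases "0 < a")
    case True
    have "complex_of_real (sqrt a * gauss_integral) ^ (2 * card I) = of_real ((sqrt a * gauss_integral) ^ (2 * card I))"
      by (simp only: of_real_power)
    also have "(sqrt a * gauss_integral) ^ (2 * card I) = a ^ card I * gauss_integral ^ (2 * card I)"
      using True by (simp add: power_mult_distrib power_mult)
    finally show ?thesis using True by (simp add: g_def powr_add powr_nat' mult_ac)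
  qed (simp add: g_def)
  have "g \<in> borel_measurable lborel"
  proof -
    have "g = (\<lambda>a. if 0 < a then exp (s * of_real (ln a)) * of_real (exp (- a)) * of_real (sqrt a * gauss_integral) ^ (2 * card I) else 0)"
      by (auto simp: g_def powr_def Ln_of_real fun_eq_iff)
    then show ?thesis by simp
  qed
  then have "(LINT y|PiM {(k, k)} (\<lambda>_. lborel). g (y (k, k))) = (LBINT a. g a)"
    by (rule lborel_prod.product_integral_singleton)
  also have "\<dots> = Gamma (s + of_nat (card I) + 1) * of_real (gauss_integral ^ (2 * card I))"
    unfolding g using s by (subst integral_mult_left_zero) (subst Gamma_integral_lborel, auto)
  finally show ?thesis by (simp add: mult.commute)
qed

text \<open>
  Integrating over the smaller block first, the translation by the column drops out.
\<close>

lemma block_Gamma_insert: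
  fixes I :: "'n::{finite,linorder} set"
  assumes k: "k \<notin> I" and s: "0 \<le> Re s"
  shows "block_Gamma s (insert k I)
    = of_real (gauss_integral ^ (2 * card I)) * Gamma (s + of_nat (card I) + 1) * block_Gamma s I"
proof -
  define K where "K = insert (k, k) (border I k)"
  have K: "finite K" "K \<inter> (I \<times> I) = {}" "K \<union> I \<times> I = insert k I \<times> insert k I"
    using k by (auto simp: K_def border_def)
  have inner: "(LINT z|PiM (I \<times> I) (\<lambda>_. lborel). block_integrand s (insert k I) (merge K (I \<times> I) (y, z)))
      = border_integrand s I k y * block_Gamma s I" for y
  proof -
    have shift: "(\<lambda>z. \<lambda>e\<in>I \<times> I. z e - schur_shift k y e) \<in> PiM (I \<times> I) (\<lambda>_. lborel) \<rightarrow>\<^sub>M PiM (I \<times> I) (\<lambda>_. lborel)"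
      by measurable
    have "(LINT z|PiM (I \<times> I) (\<lambda>_. lborel). block_integrand s I (\<lambda>e\<in>I \<times> I. z e - schur_shift k y e))
       = (LINT z|distr (PiM (I \<times> I) (\<lambda>_. lborel)) (PiM (I \<times> I) (\<lambda>_. lborel)) (\<lambda>z. \<lambda>e\<in>I \<times> I. z e - schur_shift k y e). block_integrand s I z)"
      using borel_measurable_integrable[OF integrable_block_integrand[OF s]]
      by (intro integral_distr[symmetric] shift)
    then show ?thesis
      unfolding K_def block_integrand_insert[OF k]
      by (simp add: distr_PiM_lborel_shift block_Gamma_def)
  qed
  have "block_Gamma s (insert k I) = (LINT y|PiM K (\<lambda>_. lborel). LINT z|PiM (I \<times> I) (\<lambda>_. lborel).
      block_integrand s (insert k I) (merge K (I \<times> I) (y, z)))"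
    using lborel_prod.product_integral_fold[of K "I \<times> I" "block_integrand s (insert k I)"]
      integrable_block_integrand[OF s, of "insert k I"] K by (simp add: block_Gamma_def)
  also have "\<dots> = (LINT y|PiM K (\<lambda>_. lborel). border_integrand s I k y) * block_Gamma s I"
    by (simp add: inner)
  finally show ?thesis
    using integral_border_integrand[OF k _ s] by (simp add: K_def)
qed

lemma block_Gamma_nonzero:
  assumes "0 \<le> Re s"
  shows "block_Gamma s (I :: 'n::{finite,linorder} set) \<noteq> 0"
proof -
  have "finite I" by simp
  then show ?thesis
  proof induction
    case empty
    have "block_integrand s {} x = 1" for x :: "'n \<times> 'n \<Rightarrow> real"
      by (simp add: block_integrand_def herm_block_empty pos_def_mat_1 abs_det_def)
    then show ?case
      by (simp add: block_Gamma_def PiM_empty)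
  next
    case (insert k I)
    have "Gamma (s + of_nat (card I) + 1) \<noteq> 0"
      using assms by (auto simp: Gamma_eq_zero_iff elim!: nonpos_Ints_cases' dest!: arg_cong[where f = Re])
    then show ?case
      using insert block_Gamma_insert[OF insert(2) assms] gauss_integral_pos by simp
  qed
qed

text \<open>
  In the argument \<open>\<alpha>\<close> the exponent of the determinant is \<open>\<alpha> - p\<close>; with nonnegative real part it is bounded near
  the boundary of the cone, which is the case handled by the integrability bound.
\<close>

lemma matrix_Gamma_nonzero:
  assumes "real CARD('n::{finite,linorder}) \<le> Re \<alpha>"
  shows "matrix_Gamma TYPE('n::{finite,linorder}) \<alpha> \<noteq> 0"
proof -
  define s where "s = \<alpha> - of_nat CARD('n)"
  have s: "0 \<le> Re s" using assms by (simp add: s_def)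
  have "matrix_Gamma TYPE('n) \<alpha> = (LINT X|herm_lborel. indicator {X :: 'n cmatrix. pos_def X} X *\<^sub>R (abs_det X powr s * exp (- trace X)))"
    by (simp add: matrix_Gamma_def set_lebesgue_integral_def s_def)
  also have "\<dots> = (LINT x|PiM UNIV (\<lambda>_. lborel). indicator {X :: 'n cmatrix. pos_def X} (herm_block UNIV x) *\<^sub>R
      (abs_det (herm_block UNIV x) powr s * exp (- trace (herm_block UNIV x))))"
    unfolding herm_lborel_eq_distr_PiM by (intro integral_distr herm_block_measurable) auto
  also have "\<dots> = block_Gamma s (UNIV :: 'n set)"
  proof -
    have "exp (- trace (herm_block UNIV x)) = of_real (exp (- (\<Sum>i\<in>UNIV. x (i, i))))" for x :: "'n \<times> 'n \<Rightarrow> real"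
      unfolding trace_herm_block_UNIV of_real_minus[symmetric] exp_of_real ..
    then show ?thesis
      unfolding block_Gamma_def UNIV_Times_UNIV
      by (intro Bochner_Integration.integral_cong) (auto simp: block_integrand_def)
  qed
  finally show ?thesis using block_Gamma_nonzero[OF s] by simp
qed

section \<open>The Jacobian of a congruence\<close>

lemma nn_integral_lborel_translate:
  fixes f :: "'a::euclidean_space \<Rightarrow> ennreal"
  assumes [measurable]: "f \<in> borel_measurable borel"
  shows "(\<integral>\<^sup>+ x. f (c + x) \<partial>lborel) = (\<integral>\<^sup>+ x. f x \<partial>lborel)"
proof -
  have "(\<integral>\<^sup>+ x. f (c + x) \<partial>lborel) = (\<integral>\<^sup>+ x. f x \<partial>distr lborel borel ((+) c))"
    by (subst nn_integral_distr) auto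
  then show ?thesis by (simp add: lborel_distr_plus)
qed

lemma nn_integral_lborel_reflect:
  fixes f :: "'a::euclidean_space \<Rightarrow> ennreal"
  assumes [measurable]: "f \<in> borel_measurable borel"
  shows "(\<integral>\<^sup>+ x. f (c - x) \<partial>lborel) = (\<integral>\<^sup>+ x. f x \<partial>lborel)"
proof -
  have "(\<integral>\<^sup>+ x. f x \<partial>lborel) = (\<integral>\<^sup>+ x. f (c + (-1) *\<^sub>R x) \<partial>lborel)"
    by (subst lborel_affine[of "-1" c]) (simp_all add: nn_integral_density nn_integral_distr)
  then show ?thesis by simp
qed

text \<open>
  Uniqueness of translation-invariant measures in the form of an exchange of test functions: in
  \<open>f (L x) * g y\<close> substitute \<open>L x + y\<close> for \<open>y\<close>, then translate \<open>x\<close>, then reflect and translate \<open>y\<close>.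
\<close>

lemma nn_integral_additive_exchange:
  fixes L :: "'a::euclidean_space \<Rightarrow> 'a" and f g :: "'a \<Rightarrow> ennreal"
  assumes add: "\<And>x y. L (x + y) = L x + L y" and inv: "\<And>y. L (L' y) = y"
    and [measurable]: "L \<in> borel_measurable borel" "f \<in> borel_measurable borel" "g \<in> borel_measurable borel"
  shows "(\<integral>\<^sup>+ x. f (L x) \<partial>lborel) * (\<integral>\<^sup>+ y. g y \<partial>lborel) = (\<integral>\<^sup>+ x. g (L x) \<partial>lborel) * (\<integral>\<^sup>+ y. f y \<partial>lborel)"
proof -
  have minus: "L (- z) = - L z" for z
    using add[of z "- z"] add[of 0 0] by (simp add: add_eq_0_iff)
  have "(\<integral>\<^sup>+ x. f (L x) \<partial>lborel) * (\<integral>\<^sup>+ y. g y \<partial>lborel) = (\<integral>\<^sup>+ x. \<integral>\<^sup>+ y. f (L x) * g y \<partial>lborel \<partial>lborel)"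
    by (simp add: nn_integral_cmult nn_integral_multc)
  also have "\<dots> = (\<integral>\<^sup>+ x. \<integral>\<^sup>+ y. f (L x) * g (L x + y) \<partial>lborel \<partial>lborel)"
    by (simp add: nn_integral_cmult nn_integral_lborel_translate)
  also have "\<dots> = (\<integral>\<^sup>+ y. \<integral>\<^sup>+ x. f (L x) * g (L x + y) \<partial>lborel \<partial>lborel)"
    by (rule lborel_pair.Fubini') measurable
  also have "\<dots> = (\<integral>\<^sup>+ y. \<integral>\<^sup>+ x. f (L x - y) * g (L x) \<partial>lborel \<partial>lborel)"
  proof (rule nn_integral_cong)
    fix y :: 'a
    have "(\<integral>\<^sup>+ x. f (L x) * g (L x + y) \<partial>lborel) = (\<integral>\<^sup>+ x. f (L (- L' y + x)) * g (L (- L' y + x) + y) \<partial>lborel)"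
      by (rule nn_integral_lborel_translate[symmetric, where f = "\<lambda>x. f (L x) * g (L x + y)"]) measurable
    then show "(\<integral>\<^sup>+ x. f (L x) * g (L x + y) \<partial>lborel) = (\<integral>\<^sup>+ x. f (L x - y) * g (L x) \<partial>lborel)"
      by (simp only: add minus inv) simp
  qed
  also have "\<dots> = (\<integral>\<^sup>+ x. \<integral>\<^sup>+ y. f (L x - y) * g (L x) \<partial>lborel \<partial>lborel)"
    by (rule lborel_pair.Fubini'[symmetric]) measurable
  also have "\<dots> = (\<integral>\<^sup>+ x. g (L x) \<partial>lborel) * (\<integral>\<^sup>+ y. f y \<partial>lborel)"
    by (simp add: nn_integral_multc nn_integral_cmult nn_integral_lborel_reflect mult.commute)
  finally show ?thesis .
qed

definition congruence :: "'n::{finite,linorder} cmatrix \<Rightarrow> real^'n::{finite,linorder}^'n::{finite,linorder} \<Rightarrow> real^'n::{finite,linorder}^'n::{finite,linorder}" where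
  "congruence C x = (\<chi> i j. herm_coords (C ** herm_of x ** conj_transpose C) (i, j))"

lemma herm_of_coords: "hermitian A \<Longrightarrow> herm_of (\<chi> i j. herm_coords A (i, j)) = A"
  by (simp add: herm_of_eq_block herm_block_UNIV_coords case_prod_beta')

lemma coords_herm_of: "(\<chi> i j. herm_coords (herm_of x) (i, j)) = x"
  by (auto simp: vec_eq_iff herm_coords_def herm_of_def)

lemma hermitian_congruence: "hermitian A \<Longrightarrow> hermitian (C ** A ** conj_transpose C)"
  by (simp add: hermitian_def conj_transpose_mult matrix_mul_assoc)

lemma herm_of_congruence: "herm_of (congruence C x) = C ** herm_of x ** conj_transpose C"
  unfolding congruence_def by (intro herm_of_coords hermitian_congruence hermitian_herm_of)

lemma congruence_mult: "congruence A (congruence B x) = congruence (A ** B) x"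
proof -
  have "A ** (B ** herm_of x ** conj_transpose B) ** conj_transpose A = (A ** B) ** herm_of x ** conj_transpose (A ** B)"
    by (simp add: conj_transpose_mult matrix_mul_assoc)
  then show ?thesis by (simp only: congruence_def[of A] congruence_def[of "A ** B"] herm_of_congruence)
qed

lemma congruence_mat_1: "congruence (mat 1) x = x"
  by (simp add: congruence_def coords_herm_of)

lemma herm_of_add: "herm_of (x + y) = herm_of x + herm_of y"
  by (auto simp: herm_of_def vec_eq_iff complex_eq_iff)

lemma congruence_add: "congruence C (x + y) = congruence C x + congruence C y"
proof -
  have "C ** herm_of (x + y) ** conj_transpose C = C ** herm_of x ** conj_transpose C + C ** herm_of y ** conj_transpose C"
    by (simp add: herm_of_add matrix_add_ldistrib matrix_mult_add_rdistrib)
  then show ?thesis by (simp add: congruence_def herm_coords_def vec_eq_iff)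
qed

lemma congruence_map_measurable [measurable]:
  "(\<lambda>X. C ** X ** conj_transpose C) \<in> borel_measurable (borel :: (complex^'n^'n) measure)"
  unfolding matrix_matrix_mult_def by (intro borel_measurable_continuous_onI continuous_intros)

lemma congruence_measurable [measurable]:
  "congruence (C :: 'n::{finite,linorder} cmatrix) \<in> borel_measurable borel"
proof (rule borel_measurable_matrix)
  fix i j :: 'n
  have 1: "(\<lambda>x. C ** herm_of x ** conj_transpose C) \<in> borel_measurable borel"
    using measurable_compose[OF herm_of_measurable congruence_map_measurable] .
  have "(\<lambda>X :: 'n cmatrix. Re (X $ i $ j)) \<in> borel_measurable borel" "(\<lambda>X :: 'n cmatrix. Im (X $ j $ i)) \<in> borel_measurable borel"
    by (auto intro!: borel_measurable_continuous_onI continuous_intros)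
  note this[THEN measurable_compose[OF 1]]
  then show "(\<lambda>x. congruence C x $ i $ j) \<in> borel_measurable borel"
    by (simp add: congruence_def herm_coords_def)
qed

text \<open>
  The factor by which integrals over the hermitian matrices change under \<open>X \<mapsto> C X C\<^sup>*\<close>, kept as a relation
  because its existence and its value are separate questions.
\<close>

definition congruence_jacobian :: "'n::{finite,linorder} cmatrix \<Rightarrow> real \<Rightarrow> bool" where
  "congruence_jacobian C r \<longleftrightarrow> r > 0 \<and>
     (\<forall>f \<in> borel_measurable borel. (\<integral>\<^sup>+ x. f (congruence C x) \<partial>lborel) = ennreal r * (\<integral>\<^sup>+ x. f x \<partial>lborel))"

lemma congruence_jacobianD:
  "congruence_jacobian C r \<Longrightarrow> f \<in> borel_measurable borel \<Longrightarrow>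
    (\<integral>\<^sup>+ x. f (congruence C x) \<partial>lborel) = ennreal r * (\<integral>\<^sup>+ x. f x \<partial>lborel)"
  by (simp add: congruence_jacobian_def)

lemma nn_integral_unit_box: "(\<integral>\<^sup>+ x. indicator (box 0 One) x \<partial>lborel) = (1 :: ennreal)"
  by (subst nn_integral_indicator) (auto simp: emeasure_lborel_box)

text \<open>
  Exchange an arbitrary function with the indicator of the unit box.  The resulting constant is finite
  and nonzero because, applied to the box pulled back along the inverse congruence, it must yield 1.
\<close>

lemma congruence_jacobian_exists:
  assumes "det C \<noteq> 0"
  shows "\<exists>r. congruence_jacobian C r"
proof -
  obtain D where D: "C ** D = mat 1" "D ** C = mat 1"
    using assms by (metis invertible_det_nz invertible_def)
  have CD: "congruence C (congruence D x) = x" "congruence D (congruence C x) = x" for x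
    by (simp_all add: congruence_mult D congruence_mat_1)
  define K where "K = (\<integral>\<^sup>+ x. indicator (box 0 One) (congruence C x) \<partial>lborel)"
  have K: "(\<integral>\<^sup>+ x. f (congruence C x) \<partial>lborel) = K * (\<integral>\<^sup>+ x. f x \<partial>lborel)" if "f \<in> borel_measurable borel" for f
    using nn_integral_additive_exchange[where L = "congruence C" and g = "indicator (box 0 One)", OF congruence_add CD(1) congruence_measurable that]
    by (simp add: K_def nn_integral_unit_box)
  have meas: "(\<lambda>x. indicator (box 0 One) (congruence D x)) \<in> borel_measurable borel"
    by measurable
  have 1: "1 = K * (\<integral>\<^sup>+ x. indicator (box 0 One) (congruence D x) \<partial>lborel)"
    using K[OF meas] by (simp add: CD nn_integral_unit_box)
  have "K \<noteq> 0" using 1 by auto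
  then have "0 < K" by (simp add: zero_less_iff_neq_zero)
  moreover have "K \<noteq> top"
  proof
    assume "K = top"
    with 1 show False by (simp add: ennreal_top_mult split: if_splits)
  qed
  ultimately have "congruence_jacobian C (enn2real K)"
    using K by (simp add: congruence_jacobian_def enn2real_positive_iff top.not_eq_extremum)
  then show ?thesis ..
qed

lemma congruence_jacobian_unique:
  fixes C :: "'n::{finite,linorder} cmatrix"
  assumes "congruence_jacobian C r" "congruence_jacobian C s" shows "r = s"
proof -
  define b :: "((real, 'n) vec, 'n) vec \<Rightarrow> ennreal" where "b = indicator (box 0 One)"
  have ind: "b \<in> borel_measurable borel" by (simp add: b_def)
  have "ennreal r * (\<integral>\<^sup>+ x. b x \<partial>lborel) = ennreal s * (\<integral>\<^sup>+ x. b x \<partial>lborel)"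
    by (rule trans[OF sym[OF congruence_jacobianD[OF assms(1) ind]] congruence_jacobianD[OF assms(2) ind]])
  then show ?thesis using assms by (simp add: b_def nn_integral_unit_box congruence_jacobian_def)
qed

lemma congruence_jacobian_mult:
  fixes A B :: "'n::{finite,linorder} cmatrix"
  assumes A: "congruence_jacobian A r" and B: "congruence_jacobian B s"
  shows "congruence_jacobian (A ** B) (r * s)"
  unfolding congruence_jacobian_def
proof (intro conjI ballI)
 fix f :: "((real, 'n) vec, 'n) vec \<Rightarrow> ennreal" assume f: "f \<in> borel_measurable borel"
  have "(\<integral>\<^sup>+ x. f (congruence (A ** B) x) \<partial>lborel) = (\<integral>\<^sup>+ x. f (congruence A (congruence B x)) \<partial>lborel)"
    by (simp add: congruence_mult)
  also have "\<dots> = ennreal s * (ennreal r * (\<integral>\<^sup>+ x. f x \<partial>lborel))"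
    by (simp only: congruence_jacobianD[OF B measurable_compose[OF congruence_measurable f]] congruence_jacobianD[OF A f])
  finally show "(\<integral>\<^sup>+ x. f (congruence (A ** B) x) \<partial>lborel) = ennreal (r * s) * (\<integral>\<^sup>+ x. f x \<partial>lborel)"
    using A B by (simp add: congruence_jacobian_def ennreal_mult mult_ac)
qed (use A B in \<open>simp add: congruence_jacobian_def\<close>)

lemma congruence_jacobian_mat_1: "congruence_jacobian (mat 1) 1"
  by (simp add: congruence_jacobian_def congruence_mat_1)

lemma congruence_scale_axis:
  "congruence (scale_axis k a) x $ i $ j = (if i = k then a else 1) * (if j = k then a else 1) * x $ i $ j"
  by (cases i j rule: linorder_cases)
    (auto simp: congruence_def herm_coords_def conj_transpose_scale_axis scale_axis_mult mult_scale_axis herm_of_def)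

text \<open>
  The congruence is diagonal in the coordinates: the \<open>2 (p - 1)\<close> coordinates off the diagonal in row or
  column \<open>k\<close> are multiplied by \<open>a\<close>, the diagonal one by \<open>a\<^sup>2\<close>.
\<close>

lemma congruence_jacobian_scale_axis:
  fixes k :: "'n::{finite,linorder}"
  assumes a: "a > 0"
  shows "congruence_jacobian (scale_axis k a) (1 / a ^ (2 * CARD('n)))"
proof -
  define d :: "'n \<Rightarrow> real" where "d i = (if i = k then a else 1)" for i
  define c where "c b = congruence (scale_axis k a) b \<bullet> b" for b
  have cb: "c (axis i (axis j 1)) = d i * d j" for i j
    by (simp add: c_def inner_axis congruence_scale_axis d_def)
  have T: "(\<Sum>b\<in>Basis. (c b * (x \<bullet> b)) *\<^sub>R b) = congruence (scale_axis k a) x" for x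
  proof (rule euclidean_eqI)
    fix b :: "(real, 'n) vec ^ 'n::{finite,linorder}" assume b: "b \<in> Basis"
    then obtain i j where ij: "b = axis i (axis j 1)" by (auto simp: Basis_matrix)
    have "(\<Sum>b\<in>Basis. (c b * (x \<bullet> b)) *\<^sub>R b) \<bullet> b = c b * (x \<bullet> b)"
      using b by (simp add: inner_sum_left inner_Basis if_distrib[of "\<lambda>t. _ * t"] cong: if_cong)
    also have "\<dots> = congruence (scale_axis k a) x \<bullet> b"
      unfolding ij cb by (simp add: inner_axis congruence_scale_axis d_def)
    finally show "(\<Sum>b\<in>Basis. (c b * (x \<bullet> b)) *\<^sub>R b) \<bullet> b = congruence (scale_axis k a) x \<bullet> b" .
  qed
  have d0: "d i > 0" for i using a by (simp add: d_def)
  have pd: "prod d UNIV = a" by (simp add: d_def prod.If_cases)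
  have pc: "(\<Prod>b\<in>Basis. \<bar>c b\<bar>) = a ^ (2 * CARD('n))"
  proof -
    have "(\<Prod>b\<in>Basis. \<bar>c b\<bar>) = (\<Prod>i\<in>UNIV. \<Prod>j\<in>UNIV. d i * d j)"
      using d0 by (simp add: prod_Basis_matrix cb abs_mult less_imp_le)
    also have "\<dots> = a ^ (2 * CARD('n))"
      by (simp add: prod.distrib pd mult_2 power_add prod_power_distrib[symmetric])
    finally show ?thesis .
  qed
  have c0: "c b \<noteq> 0" if "b \<in> Basis" for b
    using that d0[THEN less_imp_neq] by (auto simp: Basis_matrix cb)
  show ?thesis
    unfolding congruence_jacobian_def
  proof (intro conjI ballI)
    fix f :: "((real, 'n) vec, 'n) vec \<Rightarrow> ennreal" assume [measurable]: "f \<in> borel_measurable borel"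
    have "(\<integral>\<^sup>+ x. f x \<partial>lborel)
       = (\<integral>\<^sup>+ x. f x \<partial>density (distr lborel borel (\<lambda>x. 0 + (\<Sum>b\<in>Basis. (c b * (x \<bullet> b)) *\<^sub>R b))) (\<lambda>_. (\<Prod>b\<in>Basis. \<bar>c b\<bar>)))"
      using lborel_affine_euclidean[of c 0, OF c0] by simp
    also have "\<dots> = ennreal (a ^ (2 * CARD('n))) * (\<integral>\<^sup>+ x. f (congruence (scale_axis k a) x) \<partial>lborel)"
      unfolding T pc by (simp add: nn_integral_density nn_integral_distr nn_integral_cmult)
    finally show "(\<integral>\<^sup>+ x. f (congruence (scale_axis k a) x) \<partial>lborel) = ennreal (1 / a ^ (2 * CARD('n))) * (\<integral>\<^sup>+ x. f x \<partial>lborel)"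
      using a by (simp flip: mult.assoc ennreal_mult)
  qed (use a in simp)
qed

text \<open>
  The Jacobian is invariant under conjugation, so it equals its own square.
\<close>

lemma congruence_jacobian_of_conjugate_square:
  assumes det: "det L \<noteq> 0" and eq: "scale_axis k a ** L ** scale_axis k (1 / a) = L ** L" and a: "a > 0"
  shows "congruence_jacobian (L :: 'n::{finite,linorder} cmatrix) 1"
proof -
  obtain r where r: "congruence_jacobian L r" using congruence_jacobian_exists[OF det] ..
  have "congruence_jacobian (scale_axis k a ** L ** scale_axis k (1 / a)) (1 / a ^ (2 * CARD('n)) * r * (1 / (1 / a) ^ (2 * CARD('n))))"
    using a by (intro congruence_jacobian_mult congruence_jacobian_scale_axis r) auto
  then have "congruence_jacobian (L ** L) r" using a by (simp add: eq power_divide)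
  then have "r = r * r" using congruence_jacobian_unique congruence_jacobian_mult[OF r r] by blast
  moreover have "r > 0" using r by (simp add: congruence_jacobian_def)
  ultimately show ?thesis using r by simp
qed

lemma congruence_jacobian_unit_column:
  "congruence_jacobian (unit_column k v) 1" "congruence_jacobian (conj_transpose (unit_column k v)) 1"
proof -
  note eq = scale_axis_conjugate_unit_column[of k v]
  show "congruence_jacobian (unit_column k v) 1"
    using eq by (intro congruence_jacobian_of_conjugate_square[of _ k "1 / 2"]) (simp_all add: det_unit_column)
  have "scale_axis k 2 ** conj_transpose (unit_column k v) ** scale_axis k (1 / 2)
      = conj_transpose (unit_column k v) ** conj_transpose (unit_column k v)"
    using arg_cong[OF eq, of conj_transpose]
    by (simp add: conj_transpose_mult conj_transpose_scale_axis matrix_mul_assoc)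
  then show "congruence_jacobian (conj_transpose (unit_column k v)) 1"
    by (intro congruence_jacobian_of_conjugate_square[of _ k 2]) (simp_all add: det_unit_column det_conj_transpose)
qed

text \<open>
  Induction on the index set: by the Schur complement a block is a product of two shears, two
  scalings by the square root of the pivot, and the next smaller block.
\<close>

lemma congruence_jacobian_herm_block:
  fixes I :: "'n::{finite,linorder} set"
  assumes "pos_def (herm_block I x)"
  shows "congruence_jacobian (herm_block I x) (1 / cmod (det (herm_block I x)) ^ (2 * CARD('n)))"
proof -
  have "finite I" by simp
  then show ?thesis using assms
  proof (induction arbitrary: x)
    case empty
    then show ?case by (simp add: herm_block_empty congruence_jacobian_mat_1)
  next
    case (insert k I)
    define a where "a = x (k, k)"
    define B where "B = herm_block I (\<lambda>e. x e - schur_shift k x e)"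
    have a: "a > 0" and B: "pos_def B"
      using pos_def_herm_block_insert[OF insert(2), of x] insert(4) by (simp_all add: a_def B_def)
    have J: "congruence_jacobian B (1 / cmod (det B) ^ (2 * CARD('n)))"
      unfolding B_def by (rule insert.IH) (use B in \<open>simp add: B_def\<close>)
    define s where "s = 1 / sqrt a ^ (2 * CARD('n))"
    have s: "congruence_jacobian (scale_axis k (sqrt a)) s" for k :: 'n
      using congruence_jacobian_scale_axis[of "sqrt a" k] a by (simp add: s_def)
    have "congruence_jacobian (schur_factor I k x) (1 * s)"
      unfolding schur_factor_def a_def[symmetric] by (intro congruence_jacobian_mult congruence_jacobian_unit_column s)
    moreover have "congruence_jacobian (conj_transpose (schur_factor I k x)) (s * 1)"
      unfolding schur_factor_def a_def[symmetric] conj_transpose_mult conj_transpose_scale_axis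
      by (intro congruence_jacobian_mult congruence_jacobian_unit_column s)
    ultimately have "congruence_jacobian (schur_factor I k x ** B ** conj_transpose (schur_factor I k x))
        (1 * s * (1 / cmod (det B) ^ (2 * CARD('n))) * (s * 1))"
      by (intro congruence_jacobian_mult J)
    moreover have "schur_factor I k x ** B ** conj_transpose (schur_factor I k x) = herm_block (insert k I) x"
      using schur_complement[of k I x] insert(2) a by (simp add: a_def B_def)
    moreover have "1 * s * (1 / cmod (det B) ^ (2 * CARD('n))) * (s * 1) = 1 / (a * cmod (det B)) ^ (2 * CARD('n))"
    proof -
      have "sqrt a ^ (2 * CARD('n)) * sqrt a ^ (2 * CARD('n)) = a ^ (2 * CARD('n))"
        using a by (simp flip: power_mult_distrib)
      then show ?thesis by (simp add: s_def power_mult_distrib)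
    qed
    moreover have "cmod (det (herm_block (insert k I) x)) = a * cmod (det B)"
      using cmod_det_herm_block_insert[of k I x] insert(2) a by (simp add: a_def B_def)
    ultimately show ?case by simp
  qed
qed

lemma congruence_jacobian_pos_def:
  fixes C :: "'n::{finite,linorder} cmatrix"
  assumes "pos_def C"
  shows "congruence_jacobian C (1 / cmod (det C) ^ (2 * CARD('n)))"
  using congruence_jacobian_herm_block[of UNIV "herm_coords C"] assms
  by (simp add: herm_block_UNIV_coords pos_def_iff)

lemma distr_herm_lborel_congruence:
  fixes C :: "'n::{finite,linorder} cmatrix"
  assumes "pos_def C"
  shows "distr herm_lborel borel (\<lambda>X. C ** X ** conj_transpose C)
    = density herm_lborel (\<lambda>_. ennreal (1 / cmod (det C) ^ (2 * CARD('n))))"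
proof (rule measure_eqI)
  fix A assume "A \<in> sets (distr herm_lborel borel (\<lambda>X. C ** X ** conj_transpose C))"
  then have A [measurable]: "A \<in> sets borel" by simp
  have [measurable]: "(\<lambda>X. C ** X ** conj_transpose C) \<in> borel_measurable herm_lborel"
    by (simp add: measurable_cong_sets[OF sets_herm_lborel refl])
  have "emeasure (distr herm_lborel borel (\<lambda>X. C ** X ** conj_transpose C)) A
      = (\<integral>\<^sup>+ X. indicator A X \<partial>distr herm_lborel borel (\<lambda>X. C ** X ** conj_transpose C))"
    by simp
  also have "\<dots> = (\<integral>\<^sup>+ X. indicator A (C ** X ** conj_transpose C) \<partial>herm_lborel)"
    by (rule nn_integral_distr) measurable
  also have "\<dots> = (\<integral>\<^sup>+ x. indicator A (C ** herm_of x ** conj_transpose C) \<partial>lborel)"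
    unfolding herm_lborel_def by (rule nn_integral_distr) measurable
  also have "\<dots> = (\<integral>\<^sup>+ x. indicator A (herm_of (congruence C x)) \<partial>lborel)"
    by (simp add: herm_of_congruence)
  also have "\<dots> = ennreal (1 / cmod (det C) ^ (2 * CARD('n))) * (\<integral>\<^sup>+ x. indicator A (herm_of x) \<partial>lborel)"
  proof -
    have "(\<lambda>x. indicator A (herm_of x)) \<in> borel_measurable borel" by measurable
    then show ?thesis by (rule congruence_jacobianD[OF congruence_jacobian_pos_def[OF assms]])
  qed
  also have "(\<integral>\<^sup>+ x. indicator A (herm_of x) \<partial>lborel) = (\<integral>\<^sup>+ X. indicator A X \<partial>herm_lborel)"
    unfolding herm_lborel_def by (rule nn_integral_distr[symmetric]) measurable
  also have "ennreal (1 / cmod (det C) ^ (2 * CARD('n))) * \<dots> = emeasure (density herm_lborel (\<lambda>_. ennreal (1 / cmod (det C) ^ (2 * CARD('n))))) A"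
    by (simp add: emeasure_density nn_integral_cmult)
  finally show "emeasure (distr herm_lborel borel (\<lambda>X. C ** X ** conj_transpose C)) A
    = emeasure (density herm_lborel (\<lambda>_. ennreal (1 / cmod (det C) ^ (2 * CARD('n))))) A" .
qed simp

lemma distr_herm_lborel_translate:
  fixes U :: "'n::{finite,linorder} cmatrix"
  assumes "hermitian U"
  shows "distr herm_lborel borel (\<lambda>X. U + X) = herm_lborel"
proof -
  define u :: "(real, 'n) vec ^ 'n::{finite,linorder}" where "u = (\<chi> i j. herm_coords U (i, j))"
  have u: "herm_of u = U" using assms by (simp add: u_def herm_of_coords)
  have "distr herm_lborel borel (\<lambda>X. U + X) = distr lborel borel (\<lambda>x. U + herm_of x)"
    unfolding herm_lborel_def by (subst distr_distr) (auto simp: comp_def)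
  also have "\<dots> = distr lborel borel (\<lambda>x. herm_of (u + x))"
    by (simp add: herm_of_add u)
  also have "\<dots> = distr (distr lborel borel ((+) u)) borel herm_of"
    by (subst distr_distr) (auto simp: comp_def)
  finally show ?thesis by (simp add: lborel_distr_plus herm_lborel_def)
qed

section \<open>The Whittaker integral\<close>

definition whittaker_integrand ::
    "complex \<Rightarrow> complex \<Rightarrow> 'n::{finite,linorder} cmatrix \<Rightarrow> 'n::{finite,linorder} cmatrix \<Rightarrow> complex" where
  "whittaker_integrand s t T Z = abs_det Z powr s * abs_det (mat 1 + Z) powr t * exp (- trace (T ** Z))"

lemma trace_mult_measurable [measurable]:
  "(\<lambda>X. trace (M ** X)) \<in> borel_measurable (borel :: 'n::{finite,linorder} cmatrix measure)"
  unfolding trace_def matrix_matrix_mult_def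
  by (intro borel_measurable_continuous_onI continuous_intros)

lemma whittaker_integrand_measurable [measurable]: "whittaker_integrand s t T \<in> borel_measurable borel"
proof -
  have [measurable]: "(\<lambda>X. abs_det (mat 1 + X) powr t) \<in> borel_measurable (borel :: 'n::{finite,linorder} cmatrix measure)"
    by (rule measurable_compose[OF _ abs_det_powr_measurable]) measurable
  show ?thesis unfolding whittaker_integrand_def by measurable
qed

lemma integrable_whittaker:
  fixes T :: "'n::{finite,linorder} cmatrix"
  assumes T: "pos_def T" and s: "0 \<le> Re s"
  shows "set_integrable herm_lborel {Z. pos_def Z} (whittaker_integrand s t T)"
proof -
  obtain C e where Ce: "C \<ge> 0" "e > 0"
    "\<And>Z. pos_def Z \<Longrightarrow> cmod (whittaker_integrand s t T Z) \<le> C * exp (- e * Re (trace Z))"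
    using pos_def_integrand_bound[OF T s, of t] unfolding whittaker_integrand_def by metis
  have "integrable (PiM (UNIV \<times> UNIV) (\<lambda>_. lborel))
      (\<lambda>x. indicator {Z. pos_def Z} (herm_block UNIV x) *\<^sub>R whittaker_integrand s t T (herm_block UNIV x))"
    by (intro integrable_pos_def_exp_bound[OF _ Ce(2) Ce(3)]) measurable
  then show ?thesis
    unfolding set_integrable_def herm_lborel_eq_distr_PiM
    by (subst integrable_distr_eq) (auto intro: herm_block_measurable)
qed

text \<open>
  The defining equation is linear in its unknown, hence uniquely solvable once the coefficient is
  nonzero.
\<close>

lemma matrix_Whittaker_eq:
  fixes T :: "'n::{finite,linorder} cmatrix" and \<alpha> \<beta> :: complex
  defines "p \<equiv> of_nat CARD('n)"
  assumes T: "pos_def T" and G: "matrix_Gamma TYPE('n) (\<beta> - \<alpha> + p / 2) \<noteq> 0"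
  shows "(LINT Z:{Z. pos_def Z}|herm_lborel. whittaker_integrand (\<beta> - \<alpha> - p / 2) (\<beta> + \<alpha> - p / 2) T Z)
    = abs_det T powr (- \<beta> - p / 2) * matrix_Gamma TYPE('n) (\<beta> - \<alpha> + p / 2) * exp (trace T / 2) * matrix_Whittaker \<alpha> \<beta> T"
proof -
  define c where "c = abs_det T powr (- \<beta> - p / 2) * matrix_Gamma TYPE('n) (\<beta> - \<alpha> + p / 2) * exp (trace T / 2)"
  define L where "L = (LINT Z:{Z. pos_def Z}|herm_lborel. whittaker_integrand (\<beta> - \<alpha> - p / 2) (\<beta> + \<alpha> - p / 2) T Z)"
  have "c \<noteq> 0" using G pos_def_det_nonzero[OF T] by (simp add: c_def abs_det_def)
  then have "\<exists>!w. L = c * w" by (intro ex1I[of _ "L / c"]) auto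
  from theI'[OF this] have "L = c * (THE w. L = c * w)" .
  also have "(THE w. L = c * w) = matrix_Whittaker \<alpha> \<beta> T"
    by (simp add: matrix_Whittaker_def whittaker_integrand_def L_def c_def p_def Let_def)
  finally show ?thesis by (simp add: L_def c_def)
qed

lemma abs_det_mult: "abs_det (A ** B) = abs_det A * abs_det B"
  by (simp add: abs_det_def det_mul norm_mult)

lemma abs_det_powr_mult: "abs_det (A ** B) powr s = abs_det A powr s * abs_det B powr s"
  unfolding abs_det_mult by (simp add: abs_det_def powr_times_real)

lemma herm_lborel_substitution:
  fixes C U :: "'n::{finite,linorder} cmatrix" and F :: "'n::{finite,linorder} cmatrix \<Rightarrow> complex"
  assumes C: "pos_def C" and U: "hermitian U" and [measurable]: "F \<in> borel_measurable borel"
  shows "integrable herm_lborel F \<longleftrightarrow> integrable herm_lborel (\<lambda>Z. F (U + C ** Z ** C))"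
    and "(LINT X|herm_lborel. F X) = of_real (cmod (det C) ^ (2 * CARD('n))) * (LINT Z|herm_lborel. F (U + C ** Z ** C))"
proof -
  have CC: "conj_transpose C = C" by (rule pos_def_hermitian[OF C])
  define r where "r = 1 / cmod (det C) ^ (2 * CARD('n))"
  have r: "r > 0" using pos_def_det_nonzero[OF C] by (simp add: r_def)
  define G where "G = (\<lambda>Y. F (U + Y))"
  have G [measurable]: "G \<in> borel_measurable borel" by (simp add: G_def)
  have [measurable]: "(\<lambda>X. U + X) \<in> borel_measurable herm_lborel" "(\<lambda>X. C ** X ** C) \<in> borel_measurable herm_lborel"
    using congruence_map_measurable[of C] by (simp_all add: CC measurable_cong_sets[OF sets_herm_lborel refl])
  note tr = distr_herm_lborel_translate[OF U]
  note cg = distr_herm_lborel_congruence[OF C, unfolded CC, folded r_def]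
  have "integrable herm_lborel F \<longleftrightarrow> integrable (distr herm_lborel borel (\<lambda>X. U + X)) F" by (simp only: tr)
  also have "\<dots> \<longleftrightarrow> integrable herm_lborel G"
    unfolding G_def by (rule integrable_distr_eq) measurable
  also have "\<dots> \<longleftrightarrow> integrable (density herm_lborel (\<lambda>_. ennreal r)) G"
  proof -
    have "integrable herm_lborel G \<longleftrightarrow> integrable herm_lborel (\<lambda>Y. r *\<^sub>R G Y)"
      using integrable_scaleR_right[of r herm_lborel G] integrable_scaleR_right[of "1 / r" herm_lborel "\<lambda>Y. r *\<^sub>R G Y"] r
      by auto
    then show ?thesis
      using r by (subst integrable_density) (auto simp: measurable_cong_sets[OF sets_herm_lborel refl])
  qed
  also have "\<dots> \<longleftrightarrow> integrable herm_lborel (\<lambda>Z. G (C ** Z ** C))"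
    unfolding cg[symmetric] by (rule integrable_distr_eq) measurable
  finally show "integrable herm_lborel F \<longleftrightarrow> integrable herm_lborel (\<lambda>Z. F (U + C ** Z ** C))"
    by (simp add: G_def)
  have "(LINT Z|herm_lborel. G (C ** Z ** C)) = (LINT Y|density herm_lborel (\<lambda>_. ennreal r). G Y)"
    unfolding cg[symmetric] by (rule integral_distr[symmetric]) measurable
  also have "\<dots> = r *\<^sub>R (LINT Y|herm_lborel. G Y)"
    using r by (subst integral_density) (auto simp: measurable_cong_sets[OF sets_herm_lborel refl])
  also have "(LINT Y|herm_lborel. G Y) = (LINT X|distr herm_lborel borel (\<lambda>X. U + X). F X)"
    unfolding G_def by (rule integral_distr[symmetric]) measurable
  finally have "(LINT Z|herm_lborel. F (U + C ** Z ** C)) = r *\<^sub>R (LINT X|herm_lborel. F X)"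
    unfolding tr by (simp add: G_def)
  then show "(LINT X|herm_lborel. F X) = of_real (cmod (det C) ^ (2 * CARD('n))) * (LINT Z|herm_lborel. F (U + C ** Z ** C))"
    using r pos_def_det_nonzero[OF C] by (simp add: r_def scaleR_conv_of_real field_simps)
qed

theorem theorem3p2:
  fixes B U M :: "complex^'n::{finite,linorder}^'n::{finite,linorder}"
    and \<alpha> q :: complex
  assumes "pos_def B" and "pos_def U" and "pos_def M"
    and "Re q > real CARD('n) / 2"
  shows "let p = of_nat CARD('n);
             f = (\<lambda>X. abs_det (X + B) powr (2 * \<alpha> - p) * abs_det (X - U) powr (2 * q - p)
                       * exp (- trace (M ** X)));
             T = pd_sqrt (U + B) ** M ** pd_sqrt (U + B)
         in set_integrable herm_lborel {X. pos_def (X - U)} f \<and>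
            (LINT X:{X. pos_def (X - U)}|herm_lborel. f X)
              = matrix_Gamma TYPE('n) (2 * q)
                * abs_det (U + B) powr (\<alpha> + q - p)
                * abs_det M powr (- (\<alpha> + q))
                * exp (trace ((B - U) ** M) / 2)
                * matrix_Whittaker (\<alpha> - q) (\<alpha> + q - p / 2) T"
proof -
  define p :: complex where "p = of_nat CARD('n)"
  define D where "D = U + B"
  define C where "C = pd_sqrt D"
  define T where "T = C ** M ** C"
  define f where "f = (\<lambda>X. abs_det (X + B) powr (2 * \<alpha> - p) * abs_det (X - U) powr (2 * q - p)
                       * exp (- trace (M ** X)))"
  have D: "pos_def D" unfolding D_def by (rule pos_def_add[OF assms(2,1)])
  have C: "pos_def C" "C ** C = D" using pd_sqrt[OF D] by (simp_all add: C_def)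
  have CC: "conj_transpose C = C" by (rule pos_def_hermitian[OF C(1)])
  have T: "pos_def T"
    using pos_def_congruence[OF pos_def_det_nonzero[OF C(1)], of M] assms(3) by (simp add: T_def CC)
  have U: "hermitian U" using assms(2) by (simp add: pos_def_iff)
  have q: "0 \<le> Re (2 * q - p)" using assms(4) by (simp add: p_def)
  have D0: "abs_det D \<noteq> 0" using pos_def_det_nonzero[OF D] by (simp add: abs_det_def)
  have detCC: "abs_det (C ** X ** C) powr s = abs_det D powr s * abs_det X powr s" for X s
    by (simp add: abs_det_powr_mult C(2)[symmetric])
  define F where "F X = indicator {X. pos_def (X - U)} X *\<^sub>R f X" for X
  define h where "h Z = indicator {Z. pos_def Z} Z *\<^sub>R whittaker_integrand (2 * q - p) (2 * \<alpha> - p) T Z" for Z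
  define c where "c = abs_det D powr (2 * \<alpha> - p) * abs_det D powr (2 * q - p) * exp (- trace (M ** U))"
  have F [measurable]: "F \<in> borel_measurable borel"
  proof -
    have [measurable]: "{X. pos_def (X - U)} \<in> sets borel"
      using measurable_sets[OF _ pos_def_borel, of "\<lambda>X. X - U" borel] by (simp add: vimage_def)
    have [measurable]: "(\<lambda>X. abs_det (X + B) powr (2 * \<alpha> - p)) \<in> borel_measurable borel"
      "(\<lambda>X. abs_det (X - U) powr (2 * q - p)) \<in> borel_measurable borel"
      by (rule measurable_compose[OF _ abs_det_powr_measurable], measurable)+
    show ?thesis unfolding F_def f_def by measurable
  qed
  have FC: "F (U + C ** Z ** C) = c * h Z" for Z
  proof -
    have 1: "U + C ** Z ** C + B = C ** (mat 1 + Z) ** C"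
    proof -
      have "C ** (mat 1 + Z) ** C = D + C ** Z ** C"
        by (simp add: matrix_add_ldistrib matrix_mult_add_rdistrib C(2))
      then show ?thesis by (simp add: D_def add_ac)
    qed
    have "trace (M ** (C ** Z ** C)) = trace (T ** Z)"
      unfolding T_def by (metis matrix_mul_assoc trace_mul_sym)
    then have 2: "exp (- trace (M ** (U + C ** Z ** C))) = exp (- trace (M ** U)) * exp (- trace (T ** Z))"
      by (simp add: matrix_add_ldistrib trace_add mult_exp_exp)
    have 3: "pos_def (C ** Z ** C) \<longleftrightarrow> pos_def Z"
      using pos_def_congruence[OF pos_def_det_nonzero[OF C(1)], of Z] by (simp add: CC)
    show ?thesis
      unfolding F_def f_def h_def whittaker_integrand_def c_def 1 2
      by (simp add: detCC 3 indicator_def mult_ac)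
  qed
  have h: "integrable herm_lborel h"
    using integrable_whittaker[OF T q, of "2 * \<alpha> - p"] by (simp add: set_integrable_def h_def[abs_def])
  have int: "set_integrable herm_lborel {X. pos_def (X - U)} f"
    using herm_lborel_substitution(1)[OF C(1) U F] h
    unfolding set_integrable_def F_def[symmetric] by (simp add: FC)
  have detC: "of_real (cmod (det C) ^ (2 * CARD('n))) = abs_det D powr p"
  proof -
    have "of_real (cmod (det C) ^ (2 * CARD('n))) = abs_det D ^ CARD('n)"
      unfolding C(2)[symmetric] abs_det_mult by (simp add: power_mult abs_det_def power2_eq_square)
    also have "\<dots> = abs_det D powr p" using D0 by (simp add: p_def powr_nat')
    finally show ?thesis .
  qed
  have "matrix_Gamma TYPE('n) (2 * q) \<noteq> 0"
    using assms(4) by (intro matrix_Gamma_nonzero) simp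
  then have W: "(LINT Z|herm_lborel. h Z) = abs_det T powr (- (\<alpha> + q)) * matrix_Gamma TYPE('n) (2 * q)
      * exp (trace T / 2) * matrix_Whittaker (\<alpha> - q) (\<alpha> + q - p / 2) T"
    using matrix_Whittaker_eq[OF T, of "\<alpha> + q - p / 2" "\<alpha> - q"]
    by (simp add: set_lebesgue_integral_def h_def p_def algebra_simps)
  have "(LINT X:{X. pos_def (X - U)}|herm_lborel. f X) = (LINT X|herm_lborel. F X)"
    by (simp add: set_lebesgue_integral_def F_def)
  also have "\<dots> = abs_det D powr p * (c * (LINT Z|herm_lborel. h Z))"
    using herm_lborel_substitution(2)[OF C(1) U F] detC by (simp add: FC)
  also have "\<dots> = matrix_Gamma TYPE('n) (2 * q)
      * (abs_det D powr p * abs_det D powr (2 * \<alpha> - p) * abs_det D powr (2 * q - p) * abs_det D powr (- (\<alpha> + q)))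
      * abs_det M powr (- (\<alpha> + q)) * (exp (- trace (M ** U)) * exp (trace T / 2))
      * matrix_Whittaker (\<alpha> - q) (\<alpha> + q - p / 2) T"
    unfolding W c_def T_def[THEN arg_cong[where f = "\<lambda>T. abs_det T powr (- (\<alpha> + q))"]] detCC by (simp only: mult_ac)
  also have "abs_det D powr p * abs_det D powr (2 * \<alpha> - p) * abs_det D powr (2 * q - p) * abs_det D powr (- (\<alpha> + q))
      = abs_det D powr (\<alpha> + q - p)"
    by (simp add: powr_add[symmetric] algebra_simps)
  also have "exp (- trace (M ** U)) * exp (trace T / 2) = exp (trace ((B - U) ** M) / 2)"
  proof -
    have "trace T = trace (M ** D)"
      unfolding T_def C(2)[symmetric] by (metis matrix_mul_assoc trace_mul_sym)
    then have "trace T = trace (U ** M) + trace (B ** M)"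
      by (simp add: D_def matrix_add_ldistrib trace_add trace_mul_sym[of M])
    moreover have "trace ((B - U) ** M) = trace (B ** M) - trace (U ** M)"
      by (simp add: matrix_diff_rdistrib trace_sub)
    ultimately show ?thesis
      by (simp add: mult_exp_exp trace_mul_sym[of M] diff_divide_distrib add_divide_distrib)
  qed
  finally have eq: "(LINT X:{X. pos_def (X - U)}|herm_lborel. f X)
      = matrix_Gamma TYPE('n) (2 * q) * abs_det D powr (\<alpha> + q - p) * abs_det M powr (- (\<alpha> + q))
        * exp (trace ((B - U) ** M) / 2) * matrix_Whittaker (\<alpha> - q) (\<alpha> + q - p / 2) T" .
  show ?thesis
    unfolding Let_def p_def[symmetric] D_def[symmetric] C_def[symmetric] T_def[symmetric] f_def[symmetric]
    using int eq by simp
qed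

end
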